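(* Let $N\geq 3$ be an integer, $c_1,\ldots,c_N\in\mathbb{C}\setminus\{0\}$, $c\in\mathbb{C}$, and let $F_1(s),\ldots,F_N(s)$ be orthogonal functions each satisfying (I), (II) and (III). Let $L(s)=\sum_{j=1}^N c_jF_j(s)-c$. Then $L(s)$ has no isolated vertical lines containing zeros in the half-plane $\sigma>1$.
   Context: Write $s=\sigma+it$. For a complex function $F(s)$ consider: (I) $F(s)=\sum_{n=1}^\infty a_F(n)n^{-s}$ is absolutely convergent for $\sigma>1$; (II) $\log F(s)=\sum_p\sum_{k=1}^\infty b_F(p^k)p^{-ks}$ (sum over primes $p$) is absolutely convergent for $\sigma>1$, with $|b_F(p^k)|\ll p^{k\theta}$ for every prime $p$ and every $k\geq1$, for some $\theta<\frac12$; (III) for every $\varepsilon>0$, $|a_F(n)|\ll_\varepsilon n^{\varepsilon}$ for all $n\geq1$. Functions $F_1,\ldots,F_N$ satisfying (I) are called orthogonal if $\sum_{p\leq x}\frac{a_{F_i}(p)\overline{a_{F_j}(p)}}{p}=(m_{i,j}+o(1))\log\log x$ as $x\to\infty$, with $m_{i,i}>0$ and $m_{i,j}=0$ for $i\neq j$. A vertical line $\sigma=\beta_0$ (with $\beta_0>1$) is an isolated vertical line containing zeros of $L$ if $L$ has a zero with real part $\beta_0$ and there is $\delta>0$ such that $L$ has no zeros $\beta+i\gamma$ with $0<|\beta-\beta_0|<\delta$. *)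

theory Defs
  imports "HOL-Analysis.Analysis" "HOL-Computational_Algebra.Primes" "HOL-Library.Landau_Symbols"
begin

text \<open>
  The coefficients \<open>a n\<close>, \<open>n \<ge> 1\<close>, of a Dirichlet series are determined by the function \<open>F\<close>; they
  are passed explicitly. The values \<open>a 0\<close>, and \<open>F s\<close> for \<open>Re s \<le> 1\<close>, are unconstrained.
\<close>

definition axiom_I :: "(complex \<Rightarrow> complex) \<Rightarrow> (nat \<Rightarrow> complex) \<Rightarrow> bool" where
  "axiom_I F a \<longleftrightarrow> (\<forall>s. Re s > 1 \<longrightarrow>
     (\<lambda>n. norm (a n * of_nat n powr (- s))) summable_on {1..} \<and>
     F s = (\<Sum>\<^sub>\<infinity>n\<in>{1..}. a n * of_nat n powr (- s)))"

text \<open>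
  That the double series equals \<open>log F(s)\<close> means that it is a branch of the logarithm of \<open>F\<close> on
  \<open>Re s > 1\<close>, i.e. its exponential is \<open>F s\<close>; it need not be the principal value \<open>Ln (F s)\<close>.
  The implied constant \<open>C\<close> is uniform in \<open>p\<close> and \<open>k\<close>.
\<close>

definition axiom_II :: "(complex \<Rightarrow> complex) \<Rightarrow> bool" where
  "axiom_II F \<longleftrightarrow> (\<exists>b :: nat \<Rightarrow> complex.
     (\<forall>s. Re s > 1 \<longrightarrow>
       (\<lambda>(p, k). norm (b (p ^ k) * of_nat p powr (- (of_nat k * s))))
         summable_on ({p. prime p} \<times> {1..}) \<and>
       F s = exp (\<Sum>\<^sub>\<infinity>(p, k)\<in>{p. prime p} \<times> {1..}.
                    b (p ^ k) * of_nat p powr (- (of_nat k * s)))) \<and>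
     (\<exists>\<theta> C :: real. \<theta> < 1 / 2 \<and>
       (\<forall>p k. prime p \<longrightarrow> k \<ge> 1 \<longrightarrow> norm (b (p ^ k)) \<le> C * real p powr (real k * \<theta>))))"

definition axiom_III :: "(nat \<Rightarrow> complex) \<Rightarrow> bool" where
  "axiom_III a \<longleftrightarrow>
     (\<forall>\<epsilon>::real. \<epsilon> > 0 \<longrightarrow> (\<exists>C::real. \<forall>n\<ge>1. norm (a n) \<le> C * real n powr \<epsilon>))"

definition orthogonal_coeffs :: "nat \<Rightarrow> (nat \<Rightarrow> nat \<Rightarrow> complex) \<Rightarrow> bool" where
  "orthogonal_coeffs N a \<longleftrightarrow> (\<exists>m :: nat \<Rightarrow> nat \<Rightarrow> real.
     (\<forall>i\<in>{1..N}. m i i > 0) \<and>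
     (\<forall>i\<in>{1..N}. \<forall>j\<in>{1..N}. i \<noteq> j \<longrightarrow> m i j = 0) \<and>
     (\<forall>i\<in>{1..N}. \<forall>j\<in>{1..N}. \<exists>r :: real \<Rightarrow> complex. r \<in> o[at_top](\<lambda>_. 1) \<and>
       (\<forall>\<^sub>F x in at_top.
         (\<Sum>p | prime p \<and> real p \<le> x. a i p * cnj (a j p) / of_nat p) =
         (of_real (m i j) + r x) * of_real (ln (ln x)))))"

definition isolated_zero_line :: "(complex \<Rightarrow> complex) \<Rightarrow> real \<Rightarrow> bool" where
  "isolated_zero_line L \<beta>\<^sub>0 \<longleftrightarrow>
     (\<exists>\<gamma>. L (Complex \<beta>\<^sub>0 \<gamma>) = 0) \<and>
     (\<exists>\<delta>>0. \<forall>\<beta> \<gamma>. 0 < \<bar>\<beta> - \<beta>\<^sub>0\<bar> \<and> \<bar>\<beta> - \<beta>\<^sub>0\<bar> < \<delta> \<longrightarrow> L (Complex \<beta> \<gamma>) \<noteq> 0)"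

end

theory Submission
  imports Defs "HOL-Complex_Analysis.Complex_Analysis" "HOL-Number_Theory.Prime_Powers"
begin

text \<open>
  Write \<open>\<Phi>\<^sub>p(s, z)\<close> for the Dirichlet series \<open>L(s)\<close> in which the \<open>n\<close>-th term is multiplied by \<open>z\<close> to
  the exponent of the prime \<open>p\<close> in \<open>n\<close>, where \<open>\<bar>z\<bar> \<le> 1\<close>. For \<open>\<bar>z\<bar> = 1\<close>, Kronecker's theorem applied to
  the logarithms of the primes makes \<open>\<Phi>\<^sub>p(\<cdot>, z)\<close> a uniform limit of vertical translates of \<open>L\<close>, so by
  Hurwitz it has no zeros on either side of an isolated line \<open>Re s = \<beta>\<^sub>0\<close>. Let \<open>s\<^sub>0\<close> be a zero of \<open>L\<close> on
  that line and \<open>D\<close> a small disc around it. For large \<open>p\<close>, \<open>\<Phi>\<^sub>p(\<cdot>, z)\<close> is uniformly close to \<open>L\<close>, hence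
  has no zeros near the boundary of \<open>D\<close>; moving \<open>s\<close> inside a half of \<open>D\<close>, no zero of \<open>\<Phi>\<^sub>p(s, \<cdot>)\<close> can
  enter the unit disc through the unit circle, so \<open>\<Phi>\<^sub>p\<close> has no zeros over the two open halves of \<open>D\<close>.
  But \<open>\<Phi>\<^sub>p(\<cdot>, 0)\<close> has a zero \<open>s'\<close> in \<open>D\<close>, which therefore lies on the line, and Hurwitz in \<open>z\<close> gives
  \<open>\<Phi>\<^sub>p(s', \<cdot>) = 0\<close>; then \<open>L(s') = \<Phi>\<^sub>p(s', 1) = 0\<close>, so \<open>s' = s\<^sub>0\<close>. The derivative at \<open>z = 0\<close> is, by the Euler
  products, \<open>p\<close> to the power \<open>-s\<^sub>0\<close> times \<open>\<Sum> c\<^sub>j E\<^sub>j(p) a\<^sub>j(p)\<close> with \<open>E\<^sub>j(p) \<longlonglongrightarrow> F\<^sub>j(s\<^sub>0) \<noteq> 0\<close>. Its vanishing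
  for all large primes contradicts orthogonality.
\<close>

section \<open>Twisted Dirichlet series\<close>

text \<open>Absolute convergence at \<open>s\<close> depends only on the real part, so real
  exponents suffice; the series at \<open>\<sigma>\<close> is then a common majorant on the whole
  half-plane to its right.\<close>

definition dirichlet_abs_conv :: "(nat \<Rightarrow> complex) \<Rightarrow> bool" where
  "dirichlet_abs_conv \<alpha> \<longleftrightarrow> (\<forall>\<sigma>>1. (\<lambda>n. norm (\<alpha> n) * real n powr (-\<sigma>)) summable_on {1..})"

text \<open>One general weight covers every variant below: constant 1 for the series itself,
  \<open>n powr (-it)\<close> for vertical translates, powers of \<open>z\<close> for the twist at a
  prime, and 0-1 weights for selecting terms.\<close>

definition dirichlet_twist :: "(nat \<Rightarrow> complex) \<Rightarrow> (nat \<Rightarrow> complex) \<Rightarrow> complex \<Rightarrow> complex" where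
  "dirichlet_twist \<alpha> w s = (\<Sum>\<^sub>\<infinity>n\<in>{1..}. \<alpha> n * w n * of_nat n powr (-s))"

lemma norm_nat_powr: "norm (of_nat n powr (-s)) = real n powr (- Re s)" for s :: complex
  by (subst norm_powr_real_powr) auto

lemma powr_minus_antimono:
  assumes "\<sigma> \<le> Re s" "n \<ge> 1"
  shows "real n powr (- Re s) \<le> real n powr (-\<sigma>)"
  using assms by (intro powr_mono) auto

lemma norm_twist_term:
  assumes "\<sigma> \<le> Re s" "n \<ge> 1" "norm (w n) \<le> 1"
  shows "norm (\<alpha> n * w n * of_nat n powr (-s)) \<le> norm (\<alpha> n) * real n powr (-\<sigma>)"
proof -
  have "norm (\<alpha> n * w n * of_nat n powr (-s)) = norm (\<alpha> n) * (norm (w n) * real n powr (- Re s))"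
    by (simp add: norm_mult norm_nat_powr)
  also have "\<dots> \<le> norm (\<alpha> n) * (1 * real n powr (-\<sigma>))"
    using assms powr_minus_antimono[OF assms(1,2)] by (intro mult_left_mono mult_mono) auto
  finally show ?thesis by simp
qed

lemma summable_twist:
  assumes "dirichlet_abs_conv \<alpha>" "Re s > 1" "\<And>n. n \<ge> 1 \<Longrightarrow> norm (w n) \<le> 1"
  shows "(\<lambda>n. norm (\<alpha> n * w n * of_nat n powr (-s))) summable_on {1..}"
    and "(\<lambda>n. \<alpha> n * w n * of_nat n powr (-s)) summable_on {1..}"
proof -
  have "(\<lambda>n. norm (\<alpha> n) * real n powr (- Re s)) summable_on {1..}"
    using assms by (auto simp: dirichlet_abs_conv_def)
  then show *: "(\<lambda>n. norm (\<alpha> n * w n * of_nat n powr (-s))) summable_on {1..}"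
    by (rule Infinite_Sum.abs_summable_on_comparison_test') (use assms in \<open>auto intro!: norm_twist_term\<close>)
  show "(\<lambda>n. \<alpha> n * w n * of_nat n powr (-s)) summable_on {1..}"
    using * by (rule abs_summable_summable)
qed

text \<open>Every tail is dominated by the tail of the convergent majorant at
  \<open>\<sigma>\<close>, which involves neither \<open>s\<close> nor \<open>w\<close>. The cutoff
  is therefore uniform in both, and the limit theorems below rest on this.\<close>

lemma twist_tail:
  assumes "dirichlet_abs_conv \<alpha>" "\<sigma> > 1" "\<epsilon> > 0"
  shows "\<exists>M0. \<forall>M\<ge>M0. \<forall>s w. \<sigma> \<le> Re s \<longrightarrow> (\<forall>n\<ge>1. norm (w n) \<le> 1) \<longrightarrow>
           norm (dirichlet_twist \<alpha> w s - (\<Sum>n=1..M. \<alpha> n * w n * of_nat n powr (-s))) < \<epsilon>"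
proof -
  define f where "f = (\<lambda>n. norm (\<alpha> n) * real n powr (-\<sigma>))"
  have sf: "f summable_on {1..}"
    using assms by (auto simp: dirichlet_abs_conv_def f_def)
  then have "(sum f \<longlongrightarrow> infsum f {1..}) (finite_subsets_at_top {1..})"
    using has_sum_infsum[OF sf] by (simp only: has_sum_def)
  then have "\<forall>\<^sub>F X in finite_subsets_at_top {1..}. dist (sum f X) (infsum f {1..}) < \<epsilon>"
    using \<open>\<epsilon> > 0\<close> by (rule tendstoD)
  then obtain X where X: "finite X" "X \<subseteq> {1..}"
      "\<And>Y. finite Y \<Longrightarrow> X \<subseteq> Y \<Longrightarrow> Y \<subseteq> {1..} \<Longrightarrow> dist (sum f Y) (infsum f {1..}) < \<epsilon>"
    unfolding eventually_finite_subsets_at_top by auto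
  obtain M0 where M0: "X \<subseteq> {..M0}"
    using X(1) finite_nat_iff_bounded_le by blast
  show ?thesis
  proof (intro exI[of _ M0] allI impI)
    fix M s and w :: "nat \<Rightarrow> complex"
    assume M: "M0 \<le> M" and s: "\<sigma> \<le> Re s" and w: "\<forall>n\<ge>1. norm (w n) \<le> 1"
    define g where "g = (\<lambda>n. \<alpha> n * w n * of_nat n powr (-s))"
    have un: "{1..} = {1..M} \<union> {M<..}" "{1..M} \<inter> {M<..} = {}" by auto
    have gf: "norm (g n) \<le> f n" if "n \<ge> 1" for n
      unfolding g_def f_def by (rule norm_twist_term[where w = w, OF s that]) (use w that in blast)
    have sg: "(\<lambda>n. norm (g n)) summable_on {1..}"
      by (rule Infinite_Sum.abs_summable_on_comparison_test'[OF sf]) (use gf in auto)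
    have sg1: "(\<lambda>n. norm (g n)) summable_on {M<..}" and sf1: "f summable_on {M<..}"
      by (auto intro: summable_on_subset_banach[OF sg] summable_on_subset_banach[OF sf])
    have "infsum g {1..} = sum g {1..M} + infsum g {M<..}"
      unfolding un(1) using infsum_Un_disjoint[OF _ abs_summable_summable[OF sg1] un(2)] by simp
    then have "norm (infsum g {1..} - sum g {1..M}) = norm (infsum g {M<..})" by simp
    also have "\<dots> \<le> infsum (\<lambda>n. norm (g n)) {M<..}"
      by (rule norm_infsum_bound) (rule sg1)
    also have "\<dots> \<le> infsum f {M<..}"
      by (rule infsum_mono[OF sg1 sf1]) (use gf in auto)
    also have "infsum f {1..} = sum f {1..M} + infsum f {M<..}"
      unfolding un(1) using infsum_Un_disjoint[OF _ sf1 un(2)] by simp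
    then have "infsum f {M<..} = infsum f {1..} - sum f {1..M}" by simp
    also have "\<dots> < \<epsilon>"
    proof -
      have "X \<subseteq> {1..M}" using X(2) M0 M by force
      then have "dist (sum f {1..M}) (infsum f {1..}) < \<epsilon>" by (intro X(3)) auto
      then show ?thesis by (auto simp: dist_real_def)
    qed
    finally show "norm (dirichlet_twist \<alpha> w s - (\<Sum>n=1..M. \<alpha> n * w n * of_nat n powr (-s))) < \<epsilon>"
      by (simp add: dirichlet_twist_def g_def)
  qed
qed

text \<open>Point and weight both depend on the parameter \<open>x\<close>, so that one statement
  serves holomorphy in \<open>s\<close>, holomorphy in \<open>z\<close> and joint
  continuity.\<close>

lemma twist_partial_sums_uniform:
  assumes "dirichlet_abs_conv \<alpha>" "\<sigma> > 1"
    and "\<And>x. x \<in> K \<Longrightarrow> \<sigma> \<le> Re (f x)" "\<And>x n. x \<in> K \<Longrightarrow> n \<ge> 1 \<Longrightarrow> norm (w x n) \<le> 1"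
  shows "uniform_limit K (\<lambda>M x. \<Sum>n=1..M. \<alpha> n * w x n * of_nat n powr (- f x))
           (\<lambda>x. dirichlet_twist \<alpha> (w x) (f x)) sequentially"
proof (rule uniform_limitI)
  fix e :: real assume "e > 0"
  then obtain M0 where "\<And>M s w. M \<ge> M0 \<Longrightarrow> \<sigma> \<le> Re s \<Longrightarrow> \<forall>n\<ge>1. norm (w n) \<le> 1 \<Longrightarrow>
           norm (dirichlet_twist \<alpha> w s - (\<Sum>n=1..M. \<alpha> n * w n * of_nat n powr (-s))) < e"
    using twist_tail[OF assms(1,2)] by meson
  then have "dist (\<Sum>n=1..M. \<alpha> n * w x n * of_nat n powr (- f x)) (dirichlet_twist \<alpha> (w x) (f x)) < e"
    if "M \<ge> M0" "x \<in> K" for M x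
    using assms(3,4) that by (simp add: dist_norm norm_minus_commute)
  then show "\<forall>\<^sub>F M in sequentially. \<forall>x\<in>K. dist (\<Sum>n=1..M. \<alpha> n * w x n * of_nat n powr (- f x))
           (dirichlet_twist \<alpha> (w x) (f x)) < e"
    unfolding eventually_sequentially by blast
qed

text \<open>This is Tannery's theorem: the tails are uniformly small by \<open>twist_tail\<close>,
  and only finitely many weights have to be close to their limits.\<close>

lemma uniform_limit_twist:
  assumes "dirichlet_abs_conv \<alpha>" "\<sigma> > 1"
    and "\<And>n. n \<ge> 1 \<Longrightarrow> ((\<lambda>k. w k n) \<longlongrightarrow> v n) G"
    and "\<And>k n. n \<ge> 1 \<Longrightarrow> norm (w k n) \<le> 1" "\<And>n. n \<ge> 1 \<Longrightarrow> norm (v n) \<le> 1"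
  shows "uniform_limit {s. \<sigma> \<le> Re s} (\<lambda>k. dirichlet_twist \<alpha> (w k)) (dirichlet_twist \<alpha> v) G"
proof (rule uniform_limitI)
  fix e :: real assume e: "e > 0"
  then have "e/3 > 0" by simp
  from twist_tail[OF assms(1,2) this] obtain M where M0:
    "\<forall>M'\<ge>M. \<forall>s w. \<sigma> \<le> Re s \<longrightarrow> (\<forall>n\<ge>1. norm (w n) \<le> 1) \<longrightarrow>
       norm (dirichlet_twist \<alpha> w s - (\<Sum>n=1..M'. \<alpha> n * w n * of_nat n powr (-s))) < e/3" ..
  note M = M0[rule_format, OF order_refl]
  \<comment> \<open>Evaluating the powers at \<open>\<sigma>\<close> bounds the difference of the
    partial sums for all \<open>s\<close> in the half-plane at once.\<close>
  have "((\<lambda>k. \<Sum>n=1..M. norm (\<alpha> n) * norm (w k n - v n) * real n powr (-\<sigma>)) \<longlongrightarrow>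
          (\<Sum>n=1..M. norm (\<alpha> n) * norm (v n - v n) * real n powr (-\<sigma>))) G"
    using assms(3) by (intro tendsto_intros) auto
  from order_tendstoD(2)[OF this, of "e/3"] e
  have "\<forall>\<^sub>F k in G. (\<Sum>n=1..M. norm (\<alpha> n) * norm (w k n - v n) * real n powr (-\<sigma>)) < e/3"
    by simp
  then show "\<forall>\<^sub>F k in G. \<forall>s\<in>{s. \<sigma> \<le> Re s}. dist (dirichlet_twist \<alpha> (w k) s) (dirichlet_twist \<alpha> v s) < e"
  proof eventually_elim
    case (elim k)
    show ?case
    proof
      fix s assume "s \<in> {s. \<sigma> \<le> Re s}"
      then have s: "\<sigma> \<le> Re s" by auto
      let ?S = "\<lambda>w. \<Sum>n=1..M. \<alpha> n * w n * of_nat n powr (-s)"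
      have "norm (?S (w k) - ?S v) = norm (\<Sum>n=1..M. \<alpha> n * (w k n - v n) * of_nat n powr (-s))"
        unfolding sum_subtractf[symmetric] by (intro arg_cong[of _ _ norm] sum.cong refl) (simp only: ring_distribs)
      also have "\<dots> \<le> (\<Sum>n=1..M. norm (\<alpha> n) * norm (w k n - v n) * real n powr (-\<sigma>))"
        using powr_minus_antimono[OF s]
        by (intro order.trans[OF norm_sum] sum_mono) (auto simp: norm_mult norm_nat_powr intro!: mult_left_mono)
      finally have "norm (?S (w k) - ?S v) < e/3" using elim by simp
      moreover have "norm (dirichlet_twist \<alpha> (w k) s - ?S (w k)) < e/3"
        "norm (dirichlet_twist \<alpha> v s - ?S v) < e/3"
        by (rule M[OF s], use assms(4,5) in blast)+
      ultimately show "dist (dirichlet_twist \<alpha> (w k) s) (dirichlet_twist \<alpha> v s) < e"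
        using dist_triangle_third[of "dirichlet_twist \<alpha> (w k) s" "?S (w k)" e "?S v" "dirichlet_twist \<alpha> v s"]
        by (simp add: dist_norm norm_minus_commute)
    qed
  qed
qed

section \<open>Kronecker approximation for prime powers\<close>

text \<open>Unique factorisation: moving the negative coefficients to the other side and
  exponentiating gives two equal products of prime powers.\<close>

lemma ln_primes_linear_independent:
  assumes "finite Q" "\<And>q. q \<in> Q \<Longrightarrow> prime (q :: nat)"
    and "(\<Sum>q\<in>Q. real_of_int (u q) * ln (real q)) = 0" "q \<in> Q"
  shows "u q = 0"
proof -
  \<comment> \<open>\<open>nat\<close> sends negative integers to 0, so \<open>A u\<close> collects
    the positive exponents and \<open>A (\<lambda>q. - u q)\<close> the absolute values of the
    negative ones. Equal multiplicities then force both parts of \<open>u q\<close> to be 0.\<close>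
  define A where "A = (\<lambda>f :: nat \<Rightarrow> int. \<Prod>q\<in>Q. q ^ nat (f q))"
  have pos: "A f > 0" for f
    unfolding A_def using assms(2) prime_gt_0_nat by (intro prod_pos) auto
  have lnA: "ln (real (A f)) = (\<Sum>q\<in>Q. real (nat (f q)) * ln (real q))" for f
    using assms(1,2) by (auto simp: A_def ln_prod ln_realpow prime_gt_0_nat)
  have real_nat_diff: "real (nat i) - real (nat (- i)) = of_int i" for i
    by (cases "i \<ge> 0") auto
  have "ln (real (A u)) - ln (real (A (\<lambda>q. - u q))) = (\<Sum>q\<in>Q. real_of_int (u q) * ln (real q))"
    unfolding lnA sum_subtractf[symmetric] left_diff_distrib[symmetric]
    by (intro sum.cong refl arg_cong2[of _ _ _ _ "(*)"]) (simp add: real_nat_diff)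
  then have "ln (real (A u)) = ln (real (A (\<lambda>q. - u q)))"
    using assms(3) by simp
  then have "A u = A (\<lambda>q. - u q)"
    using pos by simp
  then have "multiplicity q (A u) = multiplicity q (A (\<lambda>q. - u q))"
    by simp
  moreover have "multiplicity q (A f) = nat (f q)" for f
    unfolding A_def using assms by (subst multiplicity_prod_prime_powers) auto
  ultimately show ?thesis by simp
qed

text \<open>Linear independence of the logarithms of primes allows the phases of
  \<open>q powr (-it)\<close> to be prescribed for finitely many primes at once: the target is
  \<open>z\<close> at \<open>p\<close> and 1 elsewhere. Multiplicativity carries the limit over to
  all \<open>n\<close>.\<close>

lemma kronecker_prime_twist:
  assumes "prime p" "norm z = 1"
  shows "\<exists>t :: nat \<Rightarrow> real. \<forall>n\<ge>1.
           (\<lambda>k. of_nat n powr (- (\<i> * t k))) \<longlonglongrightarrow> z ^ multiplicity p n"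
proof -
  define q where "q = enumerate {p :: nat. prime p}"
  have q: "prime (q i)" for i
    using enumerate_in_set[OF primes_infinite] by (auto simp: q_def)
  have inj_q: "inj q"
    unfolding q_def by (intro strict_mono_imp_inj_on strict_mono_enumerate primes_infinite)
  have range_q: "range q = {p. prime p}"
    unfolding q_def by (rule range_enumerate[OF primes_infinite])
  \<comment> \<open>Normalised so that \<open>q powr (-it)\<close> is
    \<open>exp (2 pi i t g(q))\<close>; correspondingly \<open>\<phi>\<close> below holds the target
    phases in units of full turns.\<close>
  define g where "g = (\<lambda>q :: nat. - ln (real q) / (2 * pi))"
  define \<theta> where "\<theta> = g \<circ> q"
  define \<phi> where "\<phi> = (\<lambda>i. if q i = p then Arg z / (2 * pi) else 0)"
  \<comment> \<open>Linear independence in Kronecker's theorem is over the integers, hence the reals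
    are viewed as an integer module.\<close>
  interpret Z: Modules.module "(\<lambda>r. (*) (real_of_int r))"
    by (simp add: Modules.module.intro distrib_left mult.commute)
  have inj_g: "inj_on g {p. prime p}"
    by (auto simp: g_def inj_on_def prime_gt_0_nat)
  then have inj_\<theta>: "inj \<theta>"
    unfolding \<theta>_def by (intro comp_inj_on inj_q) (simp add: range_q)
  have indep: "Z.independent (\<theta> ` {..<n})" for n
    unfolding Z.independent_explicit_module
  proof (intro allI impI)
    fix T u v assume T: "finite T" "T \<subseteq> \<theta> ` {..<n}" "(\<Sum>v\<in>T. real_of_int (u v) * v) = 0" "v \<in> T"
    from T(2) have "T \<subseteq> g ` (q ` {..<n})" by (simp add: \<theta>_def image_comp)
    then obtain Q where Q: "Q \<subseteq> q ` {..<n}" "T = g ` Q" by (elim subset_imageE) blast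
    have fQ: "finite Q" using Q(1) by (rule finite_subset) simp
    have pQ: "prime x" if "x \<in> Q" for x using that Q(1) q by auto
    have "inj_on g Q" using inj_g by (rule inj_on_subset) (use pQ in auto)
    then have "(\<Sum>x\<in>Q. real_of_int (u (g x)) * g x) = 0"
      using T(3) by (simp add: Q(2) sum.reindex)
    then have "(\<Sum>x\<in>Q. real_of_int (u (g x)) * ln (real x)) / (- (2 * pi)) = 0"
      by (simp add: sum_divide_distrib sum_negf g_def del: divide_eq_0_iff)
    then have "(\<Sum>x\<in>Q. real_of_int (u (g x)) * ln (real x)) = 0"
      by simp
    from ln_primes_linear_independent[OF fQ pQ this] T(4) Q(2) show "u v = 0" by auto
  qed
  \<comment> \<open>Treating the first \<open>k\<close> primes with error below
    \<open>1 / Suc k\<close> yields a single sequence \<open>t\<close> that works for every prime in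
    the limit.\<close>
  have "\<exists>t h. \<forall>i<k. \<bar>t * \<theta> i - of_int (h i) - \<phi> i\<bar> < 1 / Suc k" for k :: nat
    using Kronecker_thm_1[of \<theta> k "1 / Suc k" \<phi>] indep inj_\<theta>
    by (metis (mono_tags, lifting) divide_pos_pos inj_on_subset of_nat_0_less_iff top_greatest zero_less_Suc zero_less_one)
  then obtain t h where th: "\<And>k i. i < k \<Longrightarrow> \<bar>t k * \<theta> i - of_int (h k i) - \<phi> i\<bar> < 1 / Suc k"
    by metis
  have prm: "(\<lambda>k. of_nat r powr (- (\<i> * t k))) \<longlonglongrightarrow> z ^ multiplicity p r" if r: "prime r" for r
  proof -
    obtain i where i: "r = q i" using r range_q by blast
    have "(\<lambda>k. t k * \<theta> i - of_int (h k i) - \<phi> i) \<longlonglongrightarrow> 0"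
    proof (rule Lim_null_comparison)
      show "\<forall>\<^sub>F k in sequentially. norm (t k * \<theta> i - of_int (h k i) - \<phi> i) \<le> 1 / Suc k"
        using eventually_gt_at_top[of i] by eventually_elim (use th in \<open>auto intro: less_imp_le\<close>)
      show "(\<lambda>k. 1 / real (Suc k)) \<longlonglongrightarrow> 0"
        by (rule LIMSEQ_Suc[OF lim_1_over_n])
    qed
    then have "(\<lambda>k. t k * \<theta> i - of_int (h k i)) \<longlonglongrightarrow> \<phi> i"
      by (rule LIM_zero_cancel)
    \<comment> \<open>Passing to the exponential removes the integers \<open>h k i\<close>, which
      need not converge.\<close>
    then have "(\<lambda>k. exp (\<i> * of_real (2 * pi * (t k * \<theta> i - of_int (h k i))))) \<longlonglongrightarrow>
                 exp (\<i> * of_real (2 * pi * \<phi> i))"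
      by (intro tendsto_intros)
    moreover have "exp (\<i> * of_real (2 * pi * \<phi> i)) = z ^ multiplicity p r"
    proof (cases "r = p")
      case True
      then have "exp (\<i> * of_real (2 * pi * \<phi> i)) = exp (\<i> * Arg z)" by (simp add: \<phi>_def i)
      also have "\<dots> = z" using Arg_eq[of z] assms(2) by (metis mult_1 norm_zero of_real_1 zero_neq_one)
      finally show ?thesis using True r by simp
    next
      case False
      then show ?thesis
        using r assms(1) by (simp add: \<phi>_def i prime_multiplicity_other)
    qed
    moreover have "exp (\<i> * of_real (2 * pi * (t k * \<theta> i - of_int (h k i)))) = of_nat r powr (- (\<i> * t k))" for k
    proof -
      have "exp (\<i> * of_real (2 * pi * (t k * \<theta> i - of_int (h k i)))) =
            exp (\<i> * of_real (2 * pi * (t k * \<theta> i))) / exp (\<i> * (of_int (h k i) * (of_real pi * 2)))"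
        by (simp add: exp_diff[symmetric] algebra_simps)
      also have "exp (\<i> * (of_int (h k i) * (of_real pi * 2))) = 1"
        using exp_2pi_1_int[of "h k i"] by (simp add: algebra_simps)
      also have "exp (\<i> * of_real (2 * pi * (t k * \<theta> i))) = exp (- (\<i> * t k) * of_real (ln (real r)))"
        by (simp add: \<theta>_def g_def i mult.assoc)
      also have "\<dots> = of_nat r powr (- (\<i> * t k))"
        using r prime_gt_0_nat[OF r] by (simp add: powr_def Ln_of_nat)
      finally show ?thesis by simp
    qed
    ultimately show ?thesis by simp
  qed
  \<comment> \<open>Both sides are completely multiplicative in \<open>n\<close>, because
    multiplicities add up; induction over prime factors reduces to \<open>prm\<close>.\<close>
  have "(\<lambda>k. of_nat n powr (- (\<i> * t k))) \<longlonglongrightarrow> z ^ multiplicity p n" if "n \<ge> 1" for n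
    using that
  proof (induction n rule: prime_divisors_induct)
    case (factor r n)
    then have n: "n \<ge> 1" "r > 0" by (auto simp: prime_gt_0_nat)
    have "(\<lambda>k. of_nat r powr (- (\<i> * t k)) * of_nat n powr (- (\<i> * t k)))
        \<longlonglongrightarrow> z ^ multiplicity p r * z ^ multiplicity p n"
      by (intro tendsto_mult prm factor.IH factor.hyps n)
    moreover have "of_nat r powr (- (\<i> * t k)) * of_nat n powr (- (\<i> * t k)) = of_nat (r * n) powr (- (\<i> * t k))" for k
      using powr_times_real[of "of_nat r" "of_nat n" "- (\<i> * t k)"] by simp
    moreover have "multiplicity p (r * n) = multiplicity p r + multiplicity p n"
      using assms(1) n by (intro prime_elem_multiplicity_mult_distrib) auto
    ultimately show ?case by (simp add: power_add)
  qed auto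
  then show ?thesis by blast
qed

section \<open>Twists by the exponent of a prime\<close>

text \<open>Turns vertical translates into twists with unimodular weights, so that
  \<open>uniform_limit_twist\<close> applies to them.\<close>

lemma twist_shift:
  "dirichlet_twist \<alpha> (\<lambda>n. of_nat n powr (- (\<i> * of_real t))) s = dirichlet_twist \<alpha> (\<lambda>_. 1) (s + \<i> * of_real t)"
  unfolding dirichlet_twist_def
proof (intro infsum_cong)
  fix n :: nat assume "n \<in> {1..}"
  then have "of_nat n powr (- (\<i> * of_real t)) * of_nat n powr (-s) = of_nat n powr (- (s + \<i> * of_real t))"
    by (simp add: powr_add[symmetric] algebra_simps)
  then show "\<alpha> n * of_nat n powr (- (\<i> * of_real t)) * of_nat n powr (-s) =
        \<alpha> n * 1 * of_nat n powr (- (s + \<i> * of_real t))"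
    by (simp add: mult.assoc)
qed

lemma norm_nat_powr_imaginary:
  assumes "n \<ge> 1"
  shows "norm (of_nat n powr (- (\<i> * of_real t)) :: complex) = 1"
  using assms by (subst norm_nat_powr) auto

lemma norm_power_le_one: "norm z \<le> 1 \<Longrightarrow> norm (z ^ k) \<le> 1" for z :: complex
  by (simp add: norm_power power_le_one)

text \<open>The partial sums are jointly continuous and converge uniformly for real part above any
  fixed \<open>\<sigma>\<close> greater than 1. Continuity is local, so \<open>\<sigma>\<close> may
  be chosen midway between 1 and the real part of the given point.\<close>

lemma continuous_on_twist:
  assumes "dirichlet_abs_conv \<alpha>"
  shows "continuous_on ({s. Re s > 1} \<times> cball 0 1) (\<lambda>(s, z). dirichlet_twist \<alpha> (\<lambda>n. z ^ v n) s)"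
proof -
  have "continuous_on ({s. Re s > \<sigma>} \<times> cball 0 1) (\<lambda>x. dirichlet_twist \<alpha> (\<lambda>n. snd x ^ v n) (fst x))"
    if "\<sigma> > 1" for \<sigma>
  proof (rule uniform_limit_theorem)
    show "uniform_limit ({s. Re s > \<sigma>} \<times> cball 0 1)
            (\<lambda>M x. \<Sum>n=1..M. \<alpha> n * snd x ^ v n * of_nat n powr (- fst x))
            (\<lambda>x. dirichlet_twist \<alpha> (\<lambda>n. snd x ^ v n) (fst x)) sequentially"
      by (rule twist_partial_sums_uniform[OF assms that]) (auto simp: norm_power_le_one)
    show "\<forall>\<^sub>F M in sequentially. continuous_on ({s. Re s > \<sigma>} \<times> cball 0 1)
            (\<lambda>x. \<Sum>n=1..M. \<alpha> n * snd x ^ v n * of_nat n powr (- fst x))"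
      by (intro always_eventually allI continuous_intros) auto
  qed auto
  note cont = this
  show ?thesis
    unfolding case_prod_unfold
  proof (rule continuous_on_eq_continuous_within[THEN iffD2, rule_format])
    fix x :: "complex \<times> complex" assume x: "x \<in> {s. Re s > 1} \<times> cball 0 1"
    define \<sigma> where "\<sigma> = (1 + Re (fst x)) / 2"
    have \<sigma>: "1 < \<sigma>" "\<sigma> < Re (fst x)" using x by (auto simp: \<sigma>_def)
    have "x \<in> {s. Re s > \<sigma>} \<times> cball 0 1" using x \<sigma> by auto
    then have "continuous (at x within {s. Re s > \<sigma>} \<times> cball 0 1)
        (\<lambda>x. dirichlet_twist \<alpha> (\<lambda>n. snd x ^ v n) (fst x))"
      using cont[OF \<sigma>(1)] continuous_on_eq_continuous_within by blast
    moreover have "at x within {s. Re s > \<sigma>} \<times> cball 0 1 = at x within {s. Re s > 1} \<times> cball 0 1"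
    proof (rule at_within_nhd[of _ "{s. Re s > \<sigma>} \<times> UNIV"])
      show "x \<in> {s. Re s > \<sigma>} \<times> UNIV" using \<sigma> by (cases x) auto
      show "open ({s. Re s > \<sigma>} \<times> (UNIV :: complex set))"
        by (intro open_Times open_halfspace_Re_gt) auto
    qed (use \<sigma> in auto)
    ultimately show "continuous (at x within {s. Re s > 1} \<times> cball 0 1)
        (\<lambda>x. dirichlet_twist \<alpha> (\<lambda>n. snd x ^ v n) (fst x))" by simp
  qed
qed

lemma holomorphic_twist:
  assumes "dirichlet_abs_conv \<alpha>" "\<And>n. n \<ge> 1 \<Longrightarrow> norm (w n) \<le> 1"
  shows "dirichlet_twist \<alpha> w holomorphic_on {s. Re s > 1}"
proof (rule holomorphic_uniform_sequence)
  show "open {s. Re s > 1}" by (rule open_halfspace_Re_gt)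
  show "(\<lambda>s. \<Sum>n=1..M. \<alpha> n * w n * of_nat n powr (-s)) holomorphic_on {s. Re s > 1}" for M
    by (intro holomorphic_intros) auto
  fix s :: complex assume s: "s \<in> {s. Re s > 1}"
  define d where "d = (Re s - 1) / 2"
  have d: "d > 0" "Re s - d > 1" using s by (auto simp: d_def field_simps)
  have sub: "Re s - d \<le> Re x" if "x \<in> cball s d" for x
    using that abs_Re_le_cmod[of "s - x"] by (auto simp: dist_norm)
  show "\<exists>d>0. cball s d \<subseteq> {s. Re s > 1} \<and>
          uniform_limit (cball s d) (\<lambda>M s. \<Sum>n=1..M. \<alpha> n * w n * of_nat n powr (-s)) (dirichlet_twist \<alpha> w) sequentially"
  proof (intro exI[of _ d] conjI)
    show "cball s d \<subseteq> {s. Re s > 1}" using sub d by fastforce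
    show "uniform_limit (cball s d) (\<lambda>M s. \<Sum>n=1..M. \<alpha> n * w n * of_nat n powr (-s)) (dirichlet_twist \<alpha> w) sequentially"
      by (rule twist_partial_sums_uniform[OF assms(1) d(2) sub assms(2)])
  qed (rule d)
qed

lemma holomorphic_twist_parameter:
  assumes "dirichlet_abs_conv \<alpha>" "Re s > 1"
  shows "(\<lambda>z. dirichlet_twist \<alpha> (\<lambda>n. z ^ v n) s) holomorphic_on ball 0 1"
proof (rule holomorphic_uniform_sequence)
  show "(\<lambda>z. \<Sum>n=1..M. \<alpha> n * z ^ v n * of_nat n powr (-s)) holomorphic_on ball 0 1" for M
    by (intro holomorphic_intros)
  fix z :: complex assume z: "z \<in> ball 0 1"
  obtain d where d: "d > 0" "cball z d \<subseteq> ball 0 1"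
    using open_contains_cball_eq[OF open_ball[of 0 1]] z by blast
  have "uniform_limit (cball z d) (\<lambda>M z. \<Sum>n=1..M. \<alpha> n * z ^ v n * of_nat n powr (-s))
          (\<lambda>z. dirichlet_twist \<alpha> (\<lambda>n. z ^ v n) s) sequentially"
  proof (rule twist_partial_sums_uniform[OF assms])
    fix x :: complex and n assume "x \<in> cball z d"
    then have "x \<in> ball 0 1" using d(2) by blast
    then show "norm (x ^ v n) \<le> 1" by (intro norm_power_le_one) auto
  qed auto
  then show "\<exists>d>0. cball z d \<subseteq> ball 0 1 \<and> uniform_limit (cball z d) (\<lambda>M z. \<Sum>n=1..M. \<alpha> n * z ^ v n * of_nat n powr (-s))
          (\<lambda>z. dirichlet_twist \<alpha> (\<lambda>n. z ^ v n) s) sequentially"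
    using d by blast
qed auto

text \<open>The difference quotient at 0 is again a twist, with weights \<open>z ^ (v n - 1)\<close>
  for positive \<open>v n\<close> and 0 otherwise. These are bounded by 1 and tend to the indicator
  of \<open>v n = 1\<close>.\<close>

lemma twist_parameter_derivative:
  assumes "dirichlet_abs_conv \<alpha>" "Re s > 1"
  shows "((\<lambda>z. dirichlet_twist \<alpha> (\<lambda>n. z ^ v n) s) has_field_derivative
           dirichlet_twist \<alpha> (\<lambda>n. if v n = 1 then 1 else 0) s) (at 0)"
proof -
  \<comment> \<open>The guard \<open>norm z \<le> 1\<close> keeps the weights bounded by 1 for all
    \<open>z\<close>, as \<open>uniform_limit_twist\<close> demands; it holds eventually as
    \<open>z\<close> tends to 0.\<close>
  define u :: "complex \<Rightarrow> nat \<Rightarrow> complex"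
    where "u = (\<lambda>z n. if norm z \<le> 1 \<and> v n > 0 then z ^ (v n - 1) else 0)"
  have u: "norm (u z n) \<le> 1" for z n
    by (auto simp: u_def norm_power_le_one)
  have "((\<lambda>z. u z n) \<longlongrightarrow> (if v n = 1 then 1 else 0)) (at 0)" for n
  proof -
    have "((\<lambda>z::complex. if v n > 0 then z ^ (v n - 1) else 0) \<longlongrightarrow> (if v n > 0 then 0 ^ (v n - 1) else 0)) (at 0)"
      by (auto intro!: tendsto_intros)
    moreover have "\<forall>\<^sub>F z::complex in at 0. norm z \<le> 1"
      unfolding eventually_at by (intro exI[of _ 1]) auto
    then have "\<forall>\<^sub>F z in at 0. (if v n > 0 then z ^ (v n - 1) else 0) = u z n"
      by eventually_elim (simp add: u_def)
    moreover have "(if v n > 0 then 0 ^ (v n - 1) else 0) = (if v n = 1 then 1 else (0 :: complex))"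
      by auto
    ultimately show ?thesis by (auto intro: Lim_transform_eventually)
  qed
  then have "uniform_limit {s'. Re s \<le> Re s'} (\<lambda>z. dirichlet_twist \<alpha> (u z))
       (dirichlet_twist \<alpha> (\<lambda>n. if v n = 1 then 1 else 0)) (at 0)"
    by (intro uniform_limit_twist[OF assms] u) auto
  then have lim: "((\<lambda>z. dirichlet_twist \<alpha> (u z) s) \<longlongrightarrow> dirichlet_twist \<alpha> (\<lambda>n. if v n = 1 then 1 else 0) s) (at 0)"
    by (rule tendsto_uniform_limitI) auto
  have quot: "(dirichlet_twist \<alpha> (\<lambda>n. z ^ v n) s - dirichlet_twist \<alpha> (\<lambda>n. 0 ^ v n) s) / (z - 0) = dirichlet_twist \<alpha> (u z) s"
    if z: "z \<noteq> 0" "norm z \<le> 1" for z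
  proof -
    have "dirichlet_twist \<alpha> (\<lambda>n. z ^ v n) s =
            (\<Sum>\<^sub>\<infinity>n\<in>{1..}. \<alpha> n * 0 ^ v n * of_nat n powr (-s) + z * (\<alpha> n * u z n * of_nat n powr (-s)))"
      unfolding dirichlet_twist_def
    proof (intro infsum_cong)
      fix n
      \<comment> \<open>Since \<open>0 ^ 0 = 1\<close>, the value at \<open>z = 0\<close> retains
        exactly the terms with \<open>v n = 0\<close>.\<close>
      have "z ^ v n = 0 ^ v n + z * u z n"
        using z by (cases "v n") (auto simp: u_def)
      then show "\<alpha> n * z ^ v n * of_nat n powr (-s) = \<alpha> n * 0 ^ v n * of_nat n powr (-s) + z * (\<alpha> n * u z n * of_nat n powr (-s))"
        by (simp add: algebra_simps)
    qed
    also have "\<dots> = dirichlet_twist \<alpha> (\<lambda>n. 0 ^ v n) s + z * dirichlet_twist \<alpha> (u z) s"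
      unfolding dirichlet_twist_def
      unfolding infsum_cmult_right'[symmetric]
      by (intro infsum_add summable_on_cmult_right summable_twist(2)[OF assms] u norm_power_le_one) simp
    finally show ?thesis using z by simp
  qed
  show ?thesis
    unfolding has_field_derivative_iff
  proof (rule Lim_transform_eventually[OF lim])
    have "\<forall>\<^sub>F z::complex in at 0. norm z \<le> 1 \<and> z \<noteq> 0"
      unfolding eventually_at by (intro exI[of _ 1]) auto
    then show "\<forall>\<^sub>F z in at 0. dirichlet_twist \<alpha> (u z) s =
        (dirichlet_twist \<alpha> (\<lambda>n. z ^ v n) s - dirichlet_twist \<alpha> (\<lambda>n. 0 ^ v n) s) / (z - 0)"
      by eventually_elim (metis quot)
  qed
qed

text \<open>Far to the right the first surviving term dominates, so coefficients can be read off
  from the function along the integers.\<close>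

lemma twist_leading_coefficient:
  assumes "dirichlet_abs_conv \<alpha>" "\<And>n. n \<ge> 1 \<Longrightarrow> norm (w n) \<le> 1" "m \<ge> 1"
    and "\<And>n. n \<ge> 1 \<Longrightarrow> n < m \<Longrightarrow> w n = 0"
  shows "(\<lambda>k. of_nat m ^ (k + 2) * dirichlet_twist \<alpha> w (of_nat (k + 2))) \<longlonglongrightarrow> \<alpha> m * w m"
proof -
  \<comment> \<open>Writing the exponent as \<open>k + 2\<close> and moving
    \<open>(m / n) ^ k\<close> into the weight fixes the point at 2, where
    \<open>uniform_limit_twist\<close> applies. For \<open>n < m\<close> this factor would be
    unbounded; there it may be replaced by 0 because \<open>w n = 0\<close>.\<close>
  define u :: "nat \<Rightarrow> nat \<Rightarrow> complex" where "u = (\<lambda>k n. w n * (if n < m then 0 else of_real (real m / real n) ^ k))"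
  have u: "norm (u k n) \<le> 1" if "n \<ge> 1" for k n
  proof -
    have "norm (if n < m then 0 else of_real (real m / real n) ^ k :: complex) \<le> 1"
      using that by (auto simp del: of_real_divide simp: field_simps intro!: norm_power_le_one)
    then show ?thesis
      unfolding u_def norm_mult using assms(2)[OF that] by (intro mult_le_one) auto
  qed
  have "(\<lambda>k. u k n) \<longlonglongrightarrow> w n * (if n = m then 1 else 0)" if n: "n \<ge> 1" for n
  proof (cases "n > m")
    case True
    have "(\<lambda>k. of_real (real m / real n) ^ k :: complex) \<longlonglongrightarrow> 0"
      using True by (intro LIMSEQ_power_zero) (simp del: of_real_divide)
    from tendsto_mult_left[OF this, of "w n"] show ?thesis using True by (simp add: u_def)
  qed (use n in \<open>auto simp: u_def\<close>)
  then have "uniform_limit {s. 2 \<le> Re s} (\<lambda>k. dirichlet_twist \<alpha> (u k))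
       (dirichlet_twist \<alpha> (\<lambda>n. w n * (if n = m then 1 else 0))) sequentially"
    using assms(2) by (intro uniform_limit_twist[OF assms(1)] u) auto
  then have "(\<lambda>k. dirichlet_twist \<alpha> (u k) 2) \<longlonglongrightarrow> dirichlet_twist \<alpha> (\<lambda>n. w n * (if n = m then 1 else 0)) 2"
    by (rule tendsto_uniform_limitI) auto
  then have "(\<lambda>k. of_nat m ^ 2 * dirichlet_twist \<alpha> (u k) 2) \<longlonglongrightarrow>
      of_nat m ^ 2 * dirichlet_twist \<alpha> (\<lambda>n. w n * (if n = m then 1 else 0)) 2"
    by (rule tendsto_mult_left)
  moreover have "of_nat m ^ 2 * dirichlet_twist \<alpha> (\<lambda>n. w n * (if n = m then 1 else 0)) 2 = \<alpha> m * w m"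
  proof -
    have "dirichlet_twist \<alpha> (\<lambda>n. w n * (if n = m then 1 else 0)) 2 =
        (\<Sum>\<^sub>\<infinity>n\<in>{m}. \<alpha> n * (w n * (if n = m then 1 else 0)) * of_nat n powr (-2))"
      unfolding dirichlet_twist_def using assms(3) by (intro infsum_cong_neutral) auto
    also have "\<dots> = \<alpha> m * w m * of_nat m powr (-2)" by simp
    finally show ?thesis using assms(3) by (simp add: powr_minus field_simps)
  qed
  moreover have "of_nat m ^ 2 * dirichlet_twist \<alpha> (u k) 2 = of_nat m ^ (k + 2) * dirichlet_twist \<alpha> w (of_nat (k + 2))" for k
    unfolding dirichlet_twist_def infsum_cmult_right'[symmetric]
  proof (intro infsum_cong)
    fix n :: nat assume n: "n \<in> {1..}"
    have "of_nat n powr (- of_nat (k + 2)) = 1 / (of_nat n ^ (k + 2) :: complex)"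
      "of_nat n powr (-2) = 1 / (of_nat n ^ 2 :: complex)"
      using n by (simp_all add: powr_minus field_simps powr_nat' flip: of_nat_Suc)
    note pw = this
    have "of_nat m ^ 2 * (\<alpha> n * u k n * (1 / of_nat n ^ 2)) = of_nat m ^ (k + 2) * (\<alpha> n * w n * (1 / of_nat n ^ (k + 2)))"
      using n assms(4)[of n] by (cases "n < m") (auto simp: u_def field_simps power_add power2_eq_square)
    then show "of_nat m ^ 2 * (\<alpha> n * u k n * of_nat n powr (-2)) = of_nat m ^ (k + 2) * (\<alpha> n * w n * of_nat n powr (- of_nat (k + 2)))"
      by (simp only: pw)
  qed
  ultimately show ?thesis by simp
qed

text \<open>The two series share their first \<open>P\<close> terms, and both tails are below
  \<open>\<epsilon>/2\<close> whatever the weights are. The intended \<open>v\<close> is the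
  multiplicity of a prime exceeding \<open>P\<close>.\<close>

lemma twist_eventually_close:
  assumes "dirichlet_abs_conv \<alpha>" "\<sigma> > 1" "\<epsilon> > 0"
  shows "\<exists>P. \<forall>v s z. (\<forall>n\<in>{1..P}. v n = 0) \<longrightarrow> \<sigma> \<le> Re s \<longrightarrow> norm z \<le> 1 \<longrightarrow>
           norm (dirichlet_twist \<alpha> (\<lambda>n. z ^ v n) s - dirichlet_twist \<alpha> (\<lambda>_. 1) s) < \<epsilon>"
proof -
  from assms(3) have "\<epsilon>/2 > 0" by simp
  from twist_tail[OF assms(1,2) this] obtain P where
    "\<forall>M\<ge>P. \<forall>s w. \<sigma> \<le> Re s \<longrightarrow> (\<forall>n\<ge>1. norm (w n) \<le> 1) \<longrightarrow>
       norm (dirichlet_twist \<alpha> w s - (\<Sum>n=1..M. \<alpha> n * w n * of_nat n powr (-s))) < \<epsilon>/2" ..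
  note P = this[rule_format, OF order_refl]
  show ?thesis
  proof (intro exI[of _ P] allI impI)
    fix v :: "nat \<Rightarrow> nat" and s z :: complex
    assume v: "\<forall>n\<in>{1..P}. v n = 0" and s: "\<sigma> \<le> Re s" and z: "norm z \<le> 1"
    have "(\<Sum>n=1..P. \<alpha> n * z ^ v n * of_nat n powr (-s)) = (\<Sum>n=1..P. \<alpha> n * 1 * of_nat n powr (-s))"
      using v by (intro sum.cong) auto
    then show "norm (dirichlet_twist \<alpha> (\<lambda>n. z ^ v n) s - dirichlet_twist \<alpha> (\<lambda>_. 1) s) < \<epsilon>"
      using P[OF s, of "\<lambda>n. z ^ v n"] P[OF s, of "\<lambda>_. 1"] z
        norm_triangle_half_l[of "dirichlet_twist \<alpha> (\<lambda>n. z ^ v n) s" "(\<Sum>n=1..P. \<alpha> n * 1 * of_nat n powr (-s))" \<epsilon>]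
      by (simp add: norm_power_le_one)
  qed
qed

section \<open>Euler products\<close>

lemma axiom_I_twist:
  assumes "axiom_I F a"
  shows "dirichlet_abs_conv a" and "Re s > 1 \<Longrightarrow> F s = dirichlet_twist a (\<lambda>_. 1) s"
proof -
  have "(\<lambda>n. norm (a n) * real n powr (-\<sigma>)) summable_on {1..}" if "\<sigma> > 1" for \<sigma>
  proof -
    have "(\<lambda>n. norm (a n * of_nat n powr (- of_real \<sigma>))) summable_on {1..}"
      using assms that unfolding axiom_I_def by auto
    then show ?thesis by (simp add: norm_mult norm_nat_powr)
  qed
  then show "dirichlet_abs_conv a" by (auto simp: dirichlet_abs_conv_def)
  show "F s = dirichlet_twist a (\<lambda>_. 1) s" if "Re s > 1"
    using assms that by (auto simp: axiom_I_def dirichlet_twist_def)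
qed

lemma bij_betw_prime_powers:
  "bij_betw (\<lambda>(p, k). p ^ k) ({p. prime p} \<times> {1..}) {n :: nat. primepow n}"
proof -
  have "bij_betw (\<lambda>(p, k). (p, Suc k)) ({p :: nat. prime p} \<times> UNIV) ({p. prime p} \<times> {1..})"
    by (rule bij_betwI[where g = "\<lambda>(p, k). (p, k - 1)"]) auto
  moreover have "bij_betw ((\<lambda>(p, k). p ^ k) \<circ> (\<lambda>(p, k). (p, Suc k))) ({p :: nat. prime p} \<times> UNIV) {n. primepow n}"
    using bij_betw_primepows[where ?'a = nat] by (simp add: comp_def case_prod_unfold)
  ultimately show ?thesis
    using bij_betw_comp_iff by blast
qed

text \<open>Reindexing by \<open>n = p ^ k\<close> makes the logarithm an ordinary Dirichlet series
  supported on prime powers, to which the same twists apply as to \<open>F\<close>.\<close>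

lemma axiom_II_twist:
  assumes "axiom_II F"
  obtains \<beta> where "dirichlet_abs_conv \<beta>" "\<And>n. \<not> primepow n \<Longrightarrow> \<beta> n = 0"
    "\<And>s. Re s > 1 \<Longrightarrow> F s = exp (dirichlet_twist \<beta> (\<lambda>_. 1) s)"
proof -
  define PK where "PK = {p :: nat. prime p} \<times> {1 :: nat..}"
  obtain b :: "nat \<Rightarrow> complex" where
    b: "\<And>s. Re s > 1 \<Longrightarrow> (\<lambda>(p, k). norm (b (p ^ k) * of_nat p powr (- (of_nat k * s)))) summable_on PK"
       "\<And>s. Re s > 1 \<Longrightarrow> F s = exp (\<Sum>\<^sub>\<infinity>(p, k)\<in>PK. b (p ^ k) * of_nat p powr (- (of_nat k * s)))"
    using assms unfolding axiom_II_def PK_def by blast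
  define \<beta> where "\<beta> = (\<lambda>n. if primepow n then b n else 0)"
  define pw where "pw = (\<lambda>(p :: nat, k :: nat). p ^ k)"
  have bij: "bij_betw pw PK {n. primepow n}"
    unfolding pw_def PK_def by (rule bij_betw_prime_powers)
  have pp: "{n :: nat. primepow n} \<subseteq> {1..}" by (auto simp: Suc_le_eq primepow_gt_0_nat)
  have summand: "b (p ^ k) * of_nat p powr (- (of_nat k * s)) = b (pw x) * of_nat (pw x) powr (-s)"
    if "x \<in> PK" "x = (p, k)" for x p k s
  proof -
    have "p > 0" using that by (auto simp: PK_def prime_gt_0_nat)
    then have "Ln (of_nat (p ^ k)) = of_nat k * Ln (of_nat p)"
      by (subst (1 2) Ln_of_nat) (auto simp: ln_realpow)
    then show ?thesis using \<open>p > 0\<close> that(2)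
      by (simp add: pw_def powr_def mult_ac)
  qed
  have summ: "(\<lambda>n. norm (b n * of_nat n powr (-s))) summable_on {n. primepow n}" if "Re s > 1" for s
    unfolding summable_on_reindex_bij_betw[OF bij, symmetric]
    using b(1)[OF that] by (rule summable_on_cong[THEN iffD1, rotated]) (auto simp: summand case_prod_unfold)
  have sum: "(\<Sum>\<^sub>\<infinity>(p, k)\<in>PK. b (p ^ k) * of_nat p powr (- (of_nat k * s))) = dirichlet_twist \<beta> (\<lambda>_. 1) s" for s
  proof -
    have "(\<Sum>\<^sub>\<infinity>(p, k)\<in>PK. b (p ^ k) * of_nat p powr (- (of_nat k * s))) =
          (\<Sum>\<^sub>\<infinity>x\<in>PK. b (pw x) * of_nat (pw x) powr (-s))"
      by (intro infsum_cong) (auto simp: summand case_prod_unfold)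
    also have "\<dots> = (\<Sum>\<^sub>\<infinity>n\<in>{n. primepow n}. b n * of_nat n powr (-s))"
      by (rule infsum_reindex_bij_betw[OF bij])
    also have "\<dots> = dirichlet_twist \<beta> (\<lambda>_. 1) s"
      unfolding dirichlet_twist_def using pp by (intro infsum_cong_neutral) (auto simp: \<beta>_def)
    finally show ?thesis .
  qed
  have "(\<lambda>n. norm (\<beta> n) * real n powr (-\<sigma>)) summable_on {1..}" if "\<sigma> > 1" for \<sigma>
  proof -
    have "(\<lambda>n. norm (b n * of_nat n powr (- of_real \<sigma>))) summable_on {n. primepow n}"
      using that by (intro summ) auto
    then show ?thesis
      by (rule summable_on_cong_neutral[THEN iffD1, rotated -1])
         (use pp in \<open>auto simp: \<beta>_def norm_mult norm_nat_powr\<close>)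
  qed
  then show ?thesis
    using b(2) sum by (intro that[of \<beta>]) (auto simp: dirichlet_abs_conv_def \<beta>_def)
qed

text \<open>The sequence \<open>t\<close> is chosen before \<open>\<alpha>\<close>: one sequence of
  translations serves several series, so identities between them and linear combinations of them
  pass to the limit.\<close>

lemma kronecker_twist_limit:
  assumes "prime p" "norm z = 1"
  obtains t :: "nat \<Rightarrow> real" where
    "\<And>\<alpha> \<sigma>. dirichlet_abs_conv \<alpha> \<Longrightarrow> \<sigma> > 1 \<Longrightarrow>
       uniform_limit {s. \<sigma> \<le> Re s} (\<lambda>k s. dirichlet_twist \<alpha> (\<lambda>_. 1) (s + \<i> * of_real (t k)))
         (dirichlet_twist \<alpha> (\<lambda>n. z ^ multiplicity p n)) sequentially"
proof -
  obtain t :: "nat \<Rightarrow> real" where t: "\<And>n. n \<ge> 1 \<Longrightarrow>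
      (\<lambda>k. of_nat n powr (- (\<i> * t k))) \<longlonglongrightarrow> z ^ multiplicity p n"
    using kronecker_prime_twist[OF assms] by blast
  show thesis
  proof (rule that[of t])
    fix \<alpha> \<sigma> assume "dirichlet_abs_conv \<alpha>" "\<sigma> > (1 :: real)"
    from uniform_limit_twist[OF this, where w = "\<lambda>k n. of_nat n powr (- (\<i> * t k))", OF t]
    show "uniform_limit {s. \<sigma> \<le> Re s} (\<lambda>k s. dirichlet_twist \<alpha> (\<lambda>_. 1) (s + \<i> * of_real (t k)))
         (dirichlet_twist \<alpha> (\<lambda>n. z ^ multiplicity p n)) sequentially"
      unfolding twist_shift[symmetric] using assms(2) by (simp add: norm_nat_powr_imaginary norm_power_le_one)
  qed
qed

text \<open>For \<open>z\<close> on the unit circle the identity is a limit of vertical translates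
  of the untwisted one. It extends to the disc because both sides are continuous there and
  holomorphic inside.\<close>

lemma exp_twist:
  assumes "dirichlet_abs_conv a" "dirichlet_abs_conv \<beta>" "prime p" "Re s > 1" "norm z \<le> 1"
    and "\<And>s. Re s > 1 \<Longrightarrow> dirichlet_twist a (\<lambda>_. 1) s = exp (dirichlet_twist \<beta> (\<lambda>_. 1) s)"
  shows "dirichlet_twist a (\<lambda>n. z ^ multiplicity p n) s = exp (dirichlet_twist \<beta> (\<lambda>n. z ^ multiplicity p n) s)"
proof -
  define T where "T = (\<lambda>\<alpha> z. dirichlet_twist \<alpha> (\<lambda>n. z ^ multiplicity p n) s)"
  have circle: "T a z = exp (T \<beta> z)" if "norm z = 1" for z
  proof -
    obtain t where t: "\<And>\<alpha> \<sigma>. dirichlet_abs_conv \<alpha> \<Longrightarrow> \<sigma> > 1 \<Longrightarrow>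
       uniform_limit {s. \<sigma> \<le> Re s} (\<lambda>k s. dirichlet_twist \<alpha> (\<lambda>_. 1) (s + \<i> * of_real (t k)))
         (dirichlet_twist \<alpha> (\<lambda>n. z ^ multiplicity p n)) sequentially"
      using kronecker_twist_limit[OF assms(3) \<open>norm z = 1\<close>] by metis
    have lim: "(\<lambda>k. dirichlet_twist \<alpha> (\<lambda>_. 1) (s + \<i> * of_real (t k))) \<longlonglongrightarrow> T \<alpha> z"
      if "dirichlet_abs_conv \<alpha>" for \<alpha>
      using tendsto_uniform_limitI[OF t[OF that assms(4)], of s] by (simp add: T_def)
    have "(\<lambda>k. dirichlet_twist a (\<lambda>_. 1) (s + \<i> * of_real (t k))) \<longlonglongrightarrow> exp (T \<beta> z)"
      using tendsto_exp[OF lim[OF assms(2)]] assms(4,6) by simp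
    then show ?thesis using lim[OF assms(1)] LIMSEQ_unique by blast
  qed
  have cont: "continuous_on (cball 0 1) (T \<alpha>)" if "dirichlet_abs_conv \<alpha>" for \<alpha>
  proof -
    have "continuous_on (cball 0 1) ((\<lambda>(s, z). dirichlet_twist \<alpha> (\<lambda>n. z ^ multiplicity p n) s) \<circ> Pair s)"
      using assms(4)
      by (intro continuous_on_compose continuous_on_subset[OF continuous_on_twist[OF that]] continuous_intros) auto
    then show ?thesis by (simp add: T_def comp_def)
  qed
  have hol: "T \<alpha> holomorphic_on ball 0 1" if "dirichlet_abs_conv \<alpha>" for \<alpha>
    unfolding T_def by (rule holomorphic_twist_parameter[OF that assms(4)])
  \<comment> \<open>The difference vanishes on the circle, so the maximum modulus principle applies
    with bound 0.\<close>
  have "norm (T a z - exp (T \<beta> z)) \<le> 0"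
  proof (rule maximum_modulus_frontier[where S = "cball 0 1" and f = "\<lambda>z. T a z - exp (T \<beta> z)"])
    show "(\<lambda>z. T a z - exp (T \<beta> z)) holomorphic_on interior (cball 0 1)"
      using hol assms(1,2) by (auto intro!: holomorphic_intros)
    show "continuous_on (closure (cball 0 1)) (\<lambda>z. T a z - exp (T \<beta> z))"
      using cont assms(1,2) by (auto intro!: continuous_intros)
  qed (use assms(5) circle in auto)
  then show ?thesis by (simp add: T_def)
qed

text \<open>Differentiates the twisted Euler product at \<open>z = 0\<close>. The factor
  \<open>dirichlet_twist a (\<lambda>n. 0 ^ multiplicity p n) s\<close> is the series with all
  multiples of \<open>p\<close> removed, and the logarithm contributes only its term at
  \<open>p\<close>.\<close>

lemma twist_prime_multiplicity_one:
  assumes "dirichlet_abs_conv a" "dirichlet_abs_conv \<beta>" "prime p" "Re s > 1"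
    and "\<And>n. \<not> primepow n \<Longrightarrow> \<beta> n = 0"
    and "\<And>s. Re s > 1 \<Longrightarrow> dirichlet_twist a (\<lambda>_. 1) s = exp (dirichlet_twist \<beta> (\<lambda>_. 1) s)"
  shows "dirichlet_twist a (\<lambda>n. if multiplicity p n = 1 then 1 else 0) s =
           dirichlet_twist a (\<lambda>n. 0 ^ multiplicity p n) s * a p * of_nat p powr (-s)"
proof -
  define T where "T = (\<lambda>\<alpha> s z. dirichlet_twist \<alpha> (\<lambda>n. z ^ multiplicity p n) s)"
  define T1 where "T1 = (\<lambda>\<alpha> s. dirichlet_twist \<alpha> (\<lambda>n. if multiplicity p n = 1 then 1 else 0) s)"
  have p: "p > 0" using assms(3) by (rule prime_gt_0_nat)
  have mult_p: "multiplicity p p = 1" using assms(3) by simp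
  have T1_\<beta>: "T1 \<beta> s = \<beta> p * of_nat p powr (-s)" for s
  proof -
    \<comment> \<open>Among prime powers only \<open>p\<close> itself contains \<open>p\<close> to
      exactly the first power, so a single term of the logarithm survives.\<close>
    have "n = p" if n: "primepow n" "multiplicity p n = 1" for n
    proof -
      obtain q k where qk: "prime q" "k > 0" "n = q ^ k"
        using n(1) by (auto simp: primepow_def)
      then show ?thesis
        using n(2) assms(3) by (cases "p = q") (auto simp: multiplicity_prime_power prime_multiplicity_other
          prime_elem_multiplicity_power_distrib)
    qed
    then have "T1 \<beta> s = (\<Sum>\<^sub>\<infinity>n\<in>{p}. \<beta> n * of_nat n powr (-s))"
      unfolding T1_def dirichlet_twist_def using assms(5) p mult_p by (intro infsum_cong_neutral) (auto split: if_splits)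
    then show ?thesis by simp
  qed
  have key: "T1 a s = T a s 0 * (\<beta> p * of_nat p powr (-s))" if "Re s > 1" for s
  proof -
    have deriv: "((\<lambda>z. exp (T \<beta> s z)) has_field_derivative exp (T \<beta> s 0) * T1 \<beta> s) (at 0)"
      unfolding T_def T1_def by (rule DERIV_fun_exp[OF twist_parameter_derivative[OF assms(2) that]])
    have eq: "exp (T \<beta> s z) = T a s z" if "z \<in> ball 0 1" for z
      unfolding T_def using that \<open>Re s > 1\<close> by (intro exp_twist[OF assms(1-3), symmetric] assms(6)) auto
    have "(T a s has_field_derivative exp (T \<beta> s 0) * T1 \<beta> s) (at 0)"
      by (rule has_field_derivative_transform_within_open[OF deriv, where S = "ball 0 1"]) (auto simp: eq)
    then have "(T a s has_field_derivative T a s 0 * T1 \<beta> s) (at 0)"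
      by (simp add: eq)
    moreover have "(T a s has_field_derivative T1 a s) (at 0)"
      unfolding T_def T1_def by (rule twist_parameter_derivative[OF assms(1) that])
    ultimately show ?thesis using DERIV_unique T1_\<beta> by metis
  qed
  \<comment> \<open>Compare leading coefficients in \<open>key\<close> after multiplication by
    \<open>p ^ s\<close>, with \<open>s\<close> tending to infinity along the integers.\<close>
  have "a p = a 1 * \<beta> p"
  proof (rule LIMSEQ_unique)
    show "(\<lambda>k. of_nat p ^ (k + 2) * T1 a (of_nat (k + 2))) \<longlonglongrightarrow> a p"
    proof -
      let ?w = "\<lambda>n. if multiplicity p n = 1 then 1 else 0 :: complex"
      have "?w n = 0" if "n \<ge> 1" "n < p" for n
      proof -
        have "\<not> p dvd n" using that by (auto dest: dvd_imp_le)
        then show ?thesis by (simp add: not_dvd_imp_multiplicity_0)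
      qed
      then have "(\<lambda>k. of_nat p ^ (k + 2) * dirichlet_twist a ?w (of_nat (k + 2))) \<longlonglongrightarrow> a p * ?w p"
        using p by (intro twist_leading_coefficient[OF assms(1)]) auto
      then show ?thesis using mult_p by (simp add: T1_def)
    qed
    have "(\<lambda>k. of_nat 1 ^ (k + 2) * T a (of_nat (k + 2)) 0) \<longlonglongrightarrow> a 1 * 0 ^ multiplicity p 1"
      unfolding T_def by (rule twist_leading_coefficient[OF assms(1)]) (auto simp: norm_power_le_one)
    then have "(\<lambda>k. T a (of_nat (k + 2)) 0 * \<beta> p) \<longlonglongrightarrow> a 1 * \<beta> p"
      by (intro tendsto_mult) auto
    moreover have "of_nat p ^ (k + 2) * T1 a (of_nat (k + 2)) = T a (of_nat (k + 2)) 0 * \<beta> p" for k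
    proof -
      have "of_nat p powr (- of_nat (k + 2)) = 1 / (of_nat p ^ (k + 2) :: complex)"
        using p by (simp add: powr_minus field_simps powr_nat' flip: of_nat_Suc)
      then show ?thesis using p by (subst key) (simp_all add: field_simps)
    qed
    ultimately show "(\<lambda>k. of_nat p ^ (k + 2) * T1 a (of_nat (k + 2))) \<longlonglongrightarrow> a 1 * \<beta> p" by simp
  qed
  \<comment> \<open>At infinity the logarithm tends to \<open>\<beta> 1\<close>, which is 0 because
    1 is not a prime power.\<close>
  moreover have "a 1 = 1"
  proof (rule LIMSEQ_unique)
    show "(\<lambda>k. dirichlet_twist a (\<lambda>_. 1) (of_nat (k + 2))) \<longlonglongrightarrow> a 1"
      using twist_leading_coefficient[OF assms(1), of "\<lambda>_. 1" 1] by auto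
    have "(\<lambda>k. exp (dirichlet_twist \<beta> (\<lambda>_. 1) (of_nat (k + 2)))) \<longlonglongrightarrow> exp (\<beta> 1)"
      using tendsto_exp[OF twist_leading_coefficient[OF assms(2), of "\<lambda>_. 1" 1]] by auto
    then show "(\<lambda>k. dirichlet_twist a (\<lambda>_. 1) (of_nat (k + 2))) \<longlonglongrightarrow> 1"
      using assms(5)[of 1] by (subst assms(6)) auto
  qed
  ultimately show ?thesis using key[OF assms(4)] by (simp add: T_def T1_def)
qed

section \<open>Families of holomorphic functions on the disc\<close>

text \<open>By Hurwitz the limit is either zero-free or constant, and one zero leaves only the
  constant 0.\<close>

lemma hurwitz_zero_limit:
  fixes f :: "nat \<Rightarrow> complex \<Rightarrow> complex"
  assumes "open S" "connected S" "\<And>n. f n holomorphic_on S" "g holomorphic_on S"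
    and "\<And>K. compact K \<Longrightarrow> K \<subseteq> S \<Longrightarrow> uniform_limit K f g sequentially"
    and "\<And>n z. z \<in> S \<Longrightarrow> f n z \<noteq> 0" "w \<in> S" "g w = 0" "z \<in> S"
  shows "g z = 0"
proof -
  have "g constant_on S"
    using Hurwitz_no_zeros[OF assms(1-5) _ assms(6,7)] assms(8) by blast
  then show ?thesis using assms(7-9) unfolding constant_on_def by metis
qed

lemma closedin_sequentialI:
  fixes U Z :: "'a::metric_space set"
  assumes "Z \<subseteq> U" "\<And>x l. (\<And>n. x n \<in> Z) \<Longrightarrow> l \<in> U \<Longrightarrow> x \<longlonglongrightarrow> l \<Longrightarrow> l \<in> Z"
  shows "closedin (top_of_set U) Z"
  unfolding closedin_limpt islimpt_sequential using assms by blast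

text \<open>Abstracts the twisted function at a fixed prime: \<open>s\<close> is a parameter, and
  \<open>z\<close> in the closed unit disc is the variable in which zeros are followed.\<close>

locale disc_family =
  fixes S :: "complex set" and \<Phi> :: "complex \<Rightarrow> complex \<Rightarrow> complex"
  assumes joint_continuous: "continuous_on (S \<times> cball 0 1) (\<lambda>(s, z). \<Phi> s z)"
    and holomorphic_parameter: "s \<in> S \<Longrightarrow> \<Phi> s holomorphic_on ball 0 1"
begin

lemma continuous_parameter: "s \<in> S \<Longrightarrow> continuous_on (cball 0 1) (\<Phi> s)"
proof -
  assume "s \<in> S"
  then have "continuous_on (cball 0 1) ((\<lambda>(s, z). \<Phi> s z) \<circ> Pair s)"
    by (intro continuous_on_compose continuous_on_subset[OF joint_continuous] continuous_intros) auto
  then show ?thesis by (simp add: comp_def)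
qed

lemma tendsto_joint:
  assumes "x \<longlonglongrightarrow> s" "y \<longlonglongrightarrow> z" "s \<in> S" "\<And>n. x n \<in> S" "norm z \<le> 1" "\<And>n. norm (y n) \<le> 1"
  shows "(\<lambda>n. \<Phi> (x n) (y n)) \<longlonglongrightarrow> \<Phi> s z"
  using continuous_on_tendsto_compose[OF joint_continuous tendsto_Pair[OF assms(1,2)]] assms(3-6) by simp

lemma vanishes_on_closed_disc:
  assumes "s \<in> S" "\<And>z. z \<in> ball 0 1 \<Longrightarrow> \<Phi> s z = 0" "norm z \<le> 1"
  shows "\<Phi> s z = 0"
proof -
  have "z \<in> closure (ball 0 1)" "continuous_on (closure (ball 0 1)) (\<Phi> s)"
    using assms(3) continuous_parameter[OF assms(1)] by auto
  then show ?thesis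
    using continuous_constant_on_closure[of "ball 0 1" "\<Phi> s" 0 z] assms(2) by blast
qed

text \<open>Hurwitz in the variable \<open>z\<close>: joint continuity makes
  \<open>\<Phi> (x n)\<close> converge locally uniformly on the open disc, and continuity extends
  the vanishing to the circle.\<close>

lemma limit_vanishes:
  assumes "\<And>n. x n \<in> S" "x \<longlonglongrightarrow> s" "s \<in> S"
    and "\<And>n z. z \<in> ball 0 1 \<Longrightarrow> \<Phi> (x n) z \<noteq> 0"
    and "w \<in> ball 0 1" "\<Phi> s w = 0" "norm z \<le> 1"
  shows "\<Phi> s z = 0"
proof (rule vanishes_on_closed_disc[OF assms(3) _ assms(7)])
  fix z :: complex assume z: "z \<in> ball 0 1"
  show "\<Phi> s z = 0"
  proof (rule hurwitz_zero_limit[where f = "\<lambda>n. \<Phi> (x n)" and g = "\<Phi> s" and S = "ball 0 1", OF _ _ _ _ _ _ assms(5,6) z])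
    fix K :: "complex set" assume K: "compact K" "K \<subseteq> ball 0 1"
    \<comment> \<open>A convergent sequence together with its limit is compact, which makes
      \<open>\<Phi>\<close> uniformly continuous on \<open>X \<times> K\<close>.\<close>
    define X where "X = insert s (range x)"
    have "compact X" unfolding X_def by (rule compact_sequence_with_limit[OF assms(2)])
    moreover have XK: "X \<times> K \<subseteq> S \<times> cball 0 1" using assms(1,3) K(2) by (auto simp: X_def)
    ultimately have "uniformly_continuous_on (X \<times> K) (\<lambda>(s, z). \<Phi> s z)"
      by (intro compact_uniformly_continuous continuous_on_subset[OF joint_continuous] compact_Times K)
    note uc = this
    show "uniform_limit K (\<lambda>n. \<Phi> (x n)) (\<Phi> s) sequentially"
    proof (rule uniform_limitI)
      fix e :: real assume "e > 0"
      from uc[unfolded uniformly_continuous_on_def, rule_format, OF this] obtain d where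
        d: "d > 0" "\<And>u v. u \<in> X \<times> K \<Longrightarrow> v \<in> X \<times> K \<Longrightarrow> dist v u < d \<Longrightarrow>
              dist ((\<lambda>(s, z). \<Phi> s z) v) ((\<lambda>(s, z). \<Phi> s z) u) < e" by metis
      have "\<forall>\<^sub>F n in sequentially. dist (x n) s < d" using assms(2) d(1) by (rule tendstoD)
      then show "\<forall>\<^sub>F n in sequentially. \<forall>z\<in>K. dist (\<Phi> (x n) z) (\<Phi> s z) < e"
      proof eventually_elim
        case (elim n)
        show ?case
        proof
          fix z assume "z \<in> K"
          then show "dist (\<Phi> (x n) z) (\<Phi> s z) < e"
            using d(2)[of "(s, z)" "(x n, z)"] elim by (simp add: X_def dist_Pair_Pair)
        qed
      qed
    qed
  qed (use assms(1,3,4) holomorphic_parameter in auto)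
qed

text \<open>A continuity argument: the set of parameters with a zero in the closed disc is closed by
  compactness of the disc. Its complement is closed too, since by \<open>limit_vanishes\<close> a
  new zero inside would make the limit vanish on the circle as well.\<close>

lemma zero_free_connected:
  assumes "U \<subseteq> S" "connected U"
    and "\<And>s z. s \<in> U \<Longrightarrow> norm z = 1 \<Longrightarrow> \<Phi> s z \<noteq> 0"
    and "s\<^sub>1 \<in> U" "\<And>z. norm z \<le> 1 \<Longrightarrow> \<Phi> s\<^sub>1 z \<noteq> 0"
    and "s \<in> U" "norm z \<le> 1"
  shows "\<Phi> s z \<noteq> 0"
proof -
  define Z where "Z = {s \<in> U. \<exists>z. norm z \<le> 1 \<and> \<Phi> s z = 0}"
  have "closedin (top_of_set U) Z"
  proof (rule closedin_sequentialI)
    fix x l assume x: "\<And>n. x n \<in> Z" and lU: "l \<in> U" and lim: "x \<longlonglongrightarrow> l"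
    obtain y where y: "\<And>n. norm (y n) \<le> 1" "\<And>n. \<Phi> (x n) (y n) = 0"
      using x unfolding Z_def by simp metis
    then have "\<forall>n. y n \<in> cball 0 1" by auto
    then obtain w r where w: "w \<in> cball 0 1" "strict_mono r" "(y \<circ> r) \<longlonglongrightarrow> w"
      using compact_cball[of "0::complex" 1] unfolding compact_def by metis
    have "(\<lambda>n. \<Phi> ((x \<circ> r) n) ((y \<circ> r) n)) \<longlonglongrightarrow> \<Phi> l w"
      using x lU assms(1) y(1) w(1)
      by (intro tendsto_joint LIMSEQ_subseq_LIMSEQ[OF lim w(2)] w(3)) (auto simp: Z_def)
    then have "\<Phi> l w = 0"
      using y(2) by (simp add: LIMSEQ_const_iff)
    then show "l \<in> Z" using lU w(1) by (auto simp: Z_def)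
  qed (auto simp: Z_def)
  moreover have "closedin (top_of_set U) (U - Z)"
  proof (rule closedin_sequentialI)
    fix x l assume x: "\<And>n. x n \<in> U - Z" and lU: "l \<in> U" and lim: "x \<longlonglongrightarrow> l"
    have nz: "\<Phi> (x n) z \<noteq> 0" if "z \<in> ball 0 1" for n z
      using x that unfolding Z_def by fastforce
    have "\<Phi> l w \<noteq> 0" if w: "norm w \<le> 1" for w
    proof
      assume 0: "\<Phi> l w = 0"
      then have "w \<in> ball 0 1" using assms(3)[OF lU, of w] w by fastforce
      then have "\<Phi> l 1 = 0"
        using x lU assms(1) by (intro limit_vanishes[OF _ lim _ nz _ 0]) auto
      then show False using assms(3)[OF lU, of 1] by simp
    qed
    then show "l \<in> U - Z" using lU by (auto simp: Z_def)
  qed auto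
  then have "openin (top_of_set U) Z"
    by (auto simp: openin_closedin_eq Z_def)
  ultimately have "Z = {} \<or> Z = U"
    using assms(2) unfolding connected_clopen by blast
  moreover have "s\<^sub>1 \<notin> Z" using assms(5) by (auto simp: Z_def)
  ultimately have "s \<notin> Z" using assms(4) by blast
  then show ?thesis using assms(6,7) by (auto simp: Z_def)
qed

text \<open>The annulus bound survives the change from \<open>z = 1\<close> to any \<open>z\<close>
  with constant \<open>m/2\<close>. It supplies zero-free starting points in both halves of the
  disc, and forces a zero of \<open>\<Phi>\<close> at \<open>z = 0\<close> within the disc by the
  minimum principle.\<close>

lemma zero_persists:
  assumes "cball s\<^sub>0 d \<subseteq> S" "d > 0" "\<Phi> s\<^sub>0 1 = 0" "m > 0"
    and "(\<lambda>s. \<Phi> s 0) holomorphic_on S" "open S"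
    and annulus: "\<And>s. d/2 \<le> dist s\<^sub>0 s \<Longrightarrow> dist s\<^sub>0 s \<le> d \<Longrightarrow> norm (\<Phi> s 1) \<ge> m"
    and zero: "\<And>s. s \<in> cball s\<^sub>0 d \<Longrightarrow> \<Phi> s 1 = 0 \<Longrightarrow> s = s\<^sub>0"
    and close: "\<And>s z. s \<in> cball s\<^sub>0 d \<Longrightarrow> norm z \<le> 1 \<Longrightarrow> norm (\<Phi> s z - \<Phi> s 1) < m/2"
    and circle: "\<And>s z. s \<in> ball s\<^sub>0 d \<Longrightarrow> Re s \<noteq> Re s\<^sub>0 \<Longrightarrow> norm z = 1 \<Longrightarrow> \<Phi> s z \<noteq> 0"
    and "norm z \<le> 1"
  shows "\<Phi> s\<^sub>0 z = 0"
proof -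
  have far: "norm (\<Phi> s z) \<ge> m/2" if "d/2 \<le> dist s\<^sub>0 s" "dist s\<^sub>0 s \<le> d" "norm z \<le> 1" for s z
  proof -
    have "norm (\<Phi> s 1) \<le> norm (\<Phi> s z) + norm (\<Phi> s z - \<Phi> s 1)"
      by (metis add.commute norm_minus_commute norm_triangle_sub)
    then show ?thesis using annulus[OF that(1,2)] close[of s z] that by simp
  qed
  have zf: "\<Phi> s z \<noteq> 0" if s: "s \<in> ball s\<^sub>0 d" "Re s \<noteq> Re s\<^sub>0" and z: "norm z \<le> 1" for s z
  proof -
    \<comment> \<open>The sign of the half containing \<open>s\<close>, so that both halves are
      treated by one convex set \<open>U\<close>.\<close>
    define \<epsilon> :: real where "\<epsilon> = (if Re s > Re s\<^sub>0 then 1 else -1)"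
    define U where "U = ball s\<^sub>0 d \<inter> {s. inner (of_real \<epsilon>) s > inner (of_real \<epsilon>) s\<^sub>0}"
    have inner: "inner (of_real \<epsilon>) x = \<epsilon> * Re x" for x by (simp add: inner_complex_def)
    show ?thesis
    proof (rule zero_free_connected[of U])
      show "U \<subseteq> S" using assms(1) by (auto simp: U_def)
      show "connected U"
        unfolding U_def by (intro convex_connected convex_Int convex_ball convex_halfspace_gt)
      show "\<Phi> s z \<noteq> 0" if "s \<in> U" "norm z = 1" for s z
        using that by (intro circle) (auto simp: U_def inner)
      \<comment> \<open>The offset \<open>3 * d / 4\<close> puts the point inside the open disc and
        also inside the annulus where \<open>far\<close> applies.\<close>
      show "s\<^sub>0 + of_real (\<epsilon> * (3 * d / 4)) \<in> U"
        unfolding U_def inner using \<open>d > 0\<close> by (auto simp: \<epsilon>_def dist_norm norm_mult)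
      show "\<Phi> (s\<^sub>0 + of_real (\<epsilon> * (3 * d / 4))) z \<noteq> 0" if "norm z \<le> 1" for z
        using far[OF _ _ that, of "s\<^sub>0 + of_real (\<epsilon> * (3 * d / 4))"] \<open>d > 0\<close> \<open>m > 0\<close>
        by (auto simp: \<epsilon>_def dist_norm norm_mult)
      show "s \<in> U" unfolding U_def inner using s by (auto simp: \<epsilon>_def)
    qed (rule z)
  qed
  obtain s' where s': "s' \<in> cball s\<^sub>0 d" "\<Phi> s' 0 = 0"
  proof (rule ccontr)
    assume "\<not> thesis"
    with that have nz: "\<Phi> s 0 \<noteq> 0" if "s \<in> cball s\<^sub>0 d" for s using that by blast
    \<comment> \<open>Without a zero the reciprocal is holomorphic, so its boundary bound holds at
      the centre. That contradicts \<open>close\<close> at \<open>s\<^sub>0\<close>, where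
      \<open>\<Phi>\<close> vanishes for \<open>z = 1\<close>.\<close>
    have hol: "(\<lambda>s. inverse (\<Phi> s 0)) holomorphic_on cball s\<^sub>0 d"
      using nz assms(1) by (intro holomorphic_intros holomorphic_on_subset[OF assms(5)]) auto
    have "norm (inverse (\<Phi> s\<^sub>0 0)) \<le> inverse (m/2)"
    proof (rule maximum_modulus_frontier[where S = "cball s\<^sub>0 d" and f = "\<lambda>s. inverse (\<Phi> s 0)"])
      show "(\<lambda>s. inverse (\<Phi> s 0)) holomorphic_on interior (cball s\<^sub>0 d)"
        using hol by (rule holomorphic_on_subset) auto
      show "continuous_on (closure (cball s\<^sub>0 d)) (\<lambda>s. inverse (\<Phi> s 0))"
        using holomorphic_on_imp_continuous_on[OF hol] by simp
      fix s assume "s \<in> frontier (cball s\<^sub>0 d)"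
      then have "norm (\<Phi> s 0) \<ge> m/2" using \<open>d > 0\<close> by (intro far) auto
      then show "norm (inverse (\<Phi> s 0)) \<le> inverse (m/2)"
        unfolding norm_inverse using \<open>m > 0\<close> by (intro le_imp_inverse_le) auto
    qed (use \<open>d > 0\<close> in auto)
    then have "m/2 \<le> norm (\<Phi> s\<^sub>0 0)"
      unfolding norm_inverse using nz[of s\<^sub>0] \<open>d > 0\<close> \<open>m > 0\<close> by (subst (asm) inverse_le_iff_le) auto
    then show False using close[of s\<^sub>0 0] assms(2,3) by simp
  qed
  have ball: "s' \<in> ball s\<^sub>0 d"
    using far[of s' 0] s' \<open>m > 0\<close> \<open>d > 0\<close> by (cases "d/2 \<le> dist s\<^sub>0 s'") auto
  have Re: "Re s' = Re s\<^sub>0" using zf[OF ball, of 0] s'(2) by auto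
  define e where "e = d - dist s\<^sub>0 s'"
  have e: "e > 0" using ball by (simp add: e_def)
  have vanish: "\<Phi> s' z = 0" if z: "norm z \<le> 1" for z
  \<comment> \<open>Approach \<open>s'\<close> from the right: the points stay in the disc, as
    \<open>e\<close> is the distance left to its boundary, and lie off the line, where
    \<open>zf\<close> gives zero-freeness.\<close>
  proof (rule limit_vanishes[where x = "\<lambda>n. s' + of_real (e / (real n + 2))"])
    have near: "s' + of_real (e / (real n + 2)) \<in> ball s\<^sub>0 d" for n
    proof -
      have "dist s\<^sub>0 (s' + of_real (e / (real n + 2))) \<le> dist s\<^sub>0 s' + e / (real n + 2)"
        using e dist_triangle[of s\<^sub>0 "s' + of_real (e / (real n + 2))" s']
        by (simp add: dist_norm norm_of_real del: of_real_divide of_real_add)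
      also have "e / (real n + 2) < e" using e by (simp add: field_simps add_pos_nonneg)
      finally show ?thesis by (simp add: e_def)
    qed
    then show "s' + of_real (e / (real n + 2)) \<in> S" for n
      using assms(1) ball_subset_cball by blast
    have "(\<lambda>n. e / (real n + 2)) \<longlonglongrightarrow> 0"
      using LIMSEQ_ignore_initial_segment[OF lim_const_over_n[of e], of 2] by (simp add: add.commute)
    then have "(\<lambda>n. s' + of_real (e / (real n + 2))) \<longlonglongrightarrow> s' + of_real 0"
      by (intro tendsto_intros)
    then show "(\<lambda>n. s' + of_real (e / (real n + 2))) \<longlonglongrightarrow> s'" by simp
    show "\<Phi> (s' + of_real (e / (real n + 2))) z \<noteq> 0" if "z \<in> ball 0 1" for n z
      using that e by (intro zf[OF near]) (auto simp: Re)
    show "s' \<in> S" using s'(1) assms(1) by auto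
  qed (use s' z in auto)
  then have "s' = s\<^sub>0" using zero[OF s'(1)] by simp
  then show ?thesis using vanish assms by simp
qed

end

section \<open>Orthogonality\<close>

lemma filterlim_ln_ln: "filterlim (\<lambda>x::real. ln (ln x)) at_top at_top"
  by (rule filterlim_compose[OF ln_at_top ln_at_top])

lemma orthogonal_coeffs_tendsto:
  assumes "orthogonal_coeffs N a"
  obtains m where "\<And>i. i \<in> {1..N} \<Longrightarrow> m i i > (0 :: real)"
    "\<And>i j. i \<in> {1..N} \<Longrightarrow> j \<in> {1..N} \<Longrightarrow> i \<noteq> j \<Longrightarrow> m i j = 0"
    "\<And>i j. i \<in> {1..N} \<Longrightarrow> j \<in> {1..N} \<Longrightarrow>
       ((\<lambda>x. (\<Sum>p | prime p \<and> real p \<le> x. a i p * cnj (a j p) / of_nat p) / of_real (ln (ln x)))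
          \<longlongrightarrow> of_real (m i j)) at_top"
proof -
  obtain m :: "nat \<Rightarrow> nat \<Rightarrow> real" where m: "\<forall>i\<in>{1..N}. m i i > 0"
     "\<forall>i\<in>{1..N}. \<forall>j\<in>{1..N}. i \<noteq> j \<longrightarrow> m i j = 0"
     "\<forall>i\<in>{1..N}. \<forall>j\<in>{1..N}. \<exists>r :: real \<Rightarrow> complex. r \<in> o[at_top](\<lambda>_. 1) \<and>
       (\<forall>\<^sub>F x in at_top. (\<Sum>p | prime p \<and> real p \<le> x. a i p * cnj (a j p) / of_nat p) =
         (of_real (m i j) + r x) * of_real (ln (ln x)))"
    using assms unfolding orthogonal_coeffs_def by (elim exE conjE) (rule that; assumption)
  show ?thesis
  proof (rule that[of m])
    fix i j assume ij: "i \<in> {1..N}" "j \<in> {1..N}"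
    then obtain r :: "real \<Rightarrow> complex" where r: "r \<in> o[at_top](\<lambda>_. 1)"
       "\<forall>\<^sub>F x in at_top. (\<Sum>p | prime p \<and> real p \<le> x. a i p * cnj (a j p) / of_nat p) =
         (of_real (m i j) + r x) * of_real (ln (ln x))"
      using m(3) by blast
    have "(r \<longlongrightarrow> 0) at_top" using smalloD_tendsto[OF r(1)] by simp
    then have "((\<lambda>x. of_real (m i j) + r x) \<longlongrightarrow> of_real (m i j) + 0) at_top"
      by (intro tendsto_intros)
    moreover have "\<forall>\<^sub>F x::real in at_top. ln (ln x) > 0"
      using filterlim_ln_ln by (simp add: filterlim_at_top_dense)
    with r(2) have "\<forall>\<^sub>F x in at_top. of_real (m i j) + r x =
        (\<Sum>p | prime p \<and> real p \<le> x. a i p * cnj (a j p) / of_nat p) / of_real (ln (ln x))"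
      by eventually_elim auto
    ultimately show "((\<lambda>x. (\<Sum>p | prime p \<and> real p \<le> x. a i p * cnj (a j p) / of_nat p) / of_real (ln (ln x)))
          \<longlongrightarrow> of_real (m i j)) at_top"
      by (simp add: Lim_transform_eventually)
  qed (use m in auto)
qed

lemma norm_sum_mult_squared_le:
  fixes f g :: "'i \<Rightarrow> complex"
  shows "(norm (\<Sum>j\<in>J. f j * g j))\<^sup>2 \<le> (\<Sum>j\<in>J. (norm (f j))\<^sup>2) * (\<Sum>j\<in>J. (norm (g j))\<^sup>2)"
proof -
  have "(norm (\<Sum>j\<in>J. f j * g j))\<^sup>2 \<le> (\<Sum>j\<in>J. norm (f j) * norm (g j))\<^sup>2"
    by (intro power_mono order.trans[OF norm_sum]) (auto simp: norm_mult)
  also have "\<dots> \<le> (\<Sum>j\<in>J. (norm (f j))\<^sup>2) * (\<Sum>j\<in>J. (norm (g j))\<^sup>2)"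
    by (rule Cauchy_Schwarz_ineq_sum)
  finally show ?thesis .
qed

text \<open>By orthogonality the sum of \<open>u\<close> over primes up to \<open>x\<close> grows
  like \<open>MU * ln (ln x)\<close> with positive \<open>MU\<close>. A vanishing combination lets
  \<open>D j\<close> be replaced by \<open>D j - d j p\<close>, so Cauchy-Schwarz bounds
  \<open>u\<close> by an arbitrarily small multiple of \<open>v\<close>, whose sum grows only like
  \<open>MV * ln (ln x)\<close>.\<close>

lemma orthogonal_coeffs_independent:
  assumes "orthogonal_coeffs N a" "N \<ge> 1" "\<And>j. j \<in> {1..N} \<Longrightarrow> D j \<noteq> 0"
    and "\<And>j. j \<in> {1..N} \<Longrightarrow> d j \<longlonglongrightarrow> D j"
  shows "\<not> (\<forall>\<^sub>F p in sequentially. prime p \<longrightarrow> (\<Sum>j=1..N. d j p * a j p) = 0)"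
proof
  assume ev: "\<forall>\<^sub>F p in sequentially. prime p \<longrightarrow> (\<Sum>j=1..N. d j p * a j p) = 0"
  obtain m where m: "\<And>i. i \<in> {1..N} \<Longrightarrow> m i i > (0 :: real)"
    "\<And>i j. i \<in> {1..N} \<Longrightarrow> j \<in> {1..N} \<Longrightarrow> i \<noteq> j \<Longrightarrow> m i j = 0"
    "\<And>i j. i \<in> {1..N} \<Longrightarrow> j \<in> {1..N} \<Longrightarrow>
       ((\<lambda>x. (\<Sum>p | prime p \<and> real p \<le> x. a i p * cnj (a j p) / of_nat p) / of_real (ln (ln x)))
          \<longlongrightarrow> of_real (m i j)) at_top"
    by (rule orthogonal_coeffs_tendsto[OF assms(1)]) (rule that; blast)
  define X where "X = (\<lambda>x. {p :: nat. prime p \<and> real p \<le> x})"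
  have fin: "finite (X x)" for x
  proof (rule finite_subset)
    show "X x \<subseteq> {..nat \<lfloor>x\<rfloor>}" by (auto simp: X_def le_nat_floor)
  qed simp
  define l where "l = (\<lambda>x::real. ln (ln x))"
  define u where "u = (\<lambda>p. (norm (\<Sum>j=1..N. D j * a j p))\<^sup>2 / real p)"
  define v where "v = (\<lambda>p. (\<Sum>j=1..N. (norm (a j p))\<^sup>2) / real p)"
  define MU where "MU = (\<Sum>j=1..N. (norm (D j))\<^sup>2 * m j j)"
  define MV where "MV = (\<Sum>j=1..N. m j j)"
  have pos: "MU > 0" "MV > 0"
    unfolding MU_def MV_def using m(1) assms(2,3) by (auto intro!: sum_pos)
  have lim_v: "((\<lambda>x. (\<Sum>p\<in>X x. v p) / l x) \<longlongrightarrow> MV) at_top"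
  proof -
    have "((\<lambda>x. \<Sum>j=1..N. (\<Sum>p\<in>X x. a j p * cnj (a j p) / of_nat p) / of_real (l x)) \<longlongrightarrow> (\<Sum>j=1..N. of_real (m j j))) at_top"
      unfolding X_def l_def by (intro tendsto_sum m(3))
    moreover have "(\<Sum>j=1..N. (\<Sum>p\<in>X x. a j p * cnj (a j p) / of_nat p) / of_real (l x)) = of_real ((\<Sum>p\<in>X x. v p) / l x)" for x
    proof -
      have "of_real ((\<Sum>p\<in>X x. v p) / l x) = (\<Sum>p\<in>X x. \<Sum>j=1..N. a j p * cnj (a j p) / of_nat p) / of_real (l x)"
        by (simp add: v_def sum_divide_distrib complex_norm_square[symmetric])
      then show ?thesis by (subst (asm) sum.swap) (simp add: sum_divide_distrib)
    qed
    ultimately have "((\<lambda>x. of_real ((\<Sum>p\<in>X x. v p) / l x) :: complex) \<longlongrightarrow> of_real MV) at_top"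
      by (simp add: MV_def)
    then show ?thesis by (simp only: tendsto_of_real_iff)
  qed
  have lim_u: "((\<lambda>x. (\<Sum>p\<in>X x. u p) / l x) \<longlongrightarrow> MU) at_top"
  proof -
    have "((\<lambda>x. \<Sum>i=1..N. \<Sum>j=1..N. D i * cnj (D j) * ((\<Sum>p\<in>X x. a i p * cnj (a j p) / of_nat p) / of_real (l x)))
       \<longlongrightarrow> (\<Sum>i=1..N. \<Sum>j=1..N. D i * cnj (D j) * of_real (m i j))) at_top"
      unfolding X_def l_def by (intro tendsto_sum tendsto_mult_left m(3))
    moreover have "(\<Sum>i=1..N. \<Sum>j=1..N. D i * cnj (D j) * ((\<Sum>p\<in>X x. a i p * cnj (a j p) / of_nat p) / of_real (l x))) =
        of_real ((\<Sum>p\<in>X x. u p) / l x)" for x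
    proof -
      have u: "of_real (u p) = (\<Sum>i=1..N. \<Sum>j=1..N. D i * cnj (D j) * (a i p * cnj (a j p) / of_nat p))" for p
      proof -
        have "of_real (u p) = (\<Sum>j=1..N. D j * a j p) * cnj (\<Sum>j=1..N. D j * a j p) / of_nat p"
          by (simp only: u_def of_real_divide complex_norm_square of_real_of_nat_eq)
        also have "\<dots> = (\<Sum>i=1..N. \<Sum>j=1..N. D i * a i p * cnj (D j * a j p) / of_nat p)"
          unfolding cnj_sum sum_product sum_divide_distrib ..
        finally show ?thesis by (simp add: mult_ac)
      qed
      have "(\<Sum>i=1..N. \<Sum>j=1..N. D i * cnj (D j) * ((\<Sum>p\<in>X x. a i p * cnj (a j p) / of_nat p) / of_real (l x))) =
        (\<Sum>i=1..N. \<Sum>j=1..N. \<Sum>p\<in>X x. D i * cnj (D j) * (a i p * cnj (a j p) / of_nat p) / of_real (l x))"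
        by (simp add: sum_divide_distrib sum_distrib_left)
      also have "\<dots> = (\<Sum>i=1..N. \<Sum>p\<in>X x. \<Sum>j=1..N. D i * cnj (D j) * (a i p * cnj (a j p) / of_nat p) / of_real (l x))"
        by (intro sum.cong refl sum.swap)
      also have "\<dots> = (\<Sum>p\<in>X x. \<Sum>i=1..N. \<Sum>j=1..N. D i * cnj (D j) * (a i p * cnj (a j p) / of_nat p) / of_real (l x))"
        by (rule sum.swap)
      finally show ?thesis by (simp add: u sum_divide_distrib)
    qed
    \<comment> \<open>Orthogonality enters here: the cross terms disappear and a positive diagonal
      form remains.\<close>
    moreover have "(\<Sum>i=1..N. \<Sum>j=1..N. D i * cnj (D j) * of_real (m i j)) = of_real MU"
    proof -
      have "(\<Sum>j=1..N. D i * cnj (D j) * of_real (m i j)) = of_real ((norm (D i))\<^sup>2 * m i i)" if "i \<in> {1..N}" for i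
      proof -
        have "(\<Sum>j=1..N. D i * cnj (D j) * of_real (m i j)) = (\<Sum>j\<in>{i}. D i * cnj (D j) * of_real (m i j))"
          using that m(2)[OF that] by (intro sum.mono_neutral_right) auto
        then show ?thesis by (simp add: complex_norm_square[symmetric])
      qed
      then show ?thesis unfolding MU_def of_real_sum by (intro sum.cong) auto
    qed
    ultimately have "((\<lambda>x. of_real ((\<Sum>p\<in>X x. u p) / l x) :: complex) \<longlongrightarrow> of_real MU) at_top"
      by simp
    then show ?thesis by (simp only: tendsto_of_real_iff)
  qed
  \<comment> \<open>Chosen so that \<open>\<epsilon> * MV\<close> is half of \<open>MU\<close>,
    which contradicts the final comparison of limits.\<close>
  define \<epsilon> where "\<epsilon> = MU / (2 * MV)"
  have \<epsilon>: "\<epsilon> > 0" using pos by (simp add: \<epsilon>_def)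
  have "(\<lambda>p. \<Sum>j=1..N. (norm (D j - d j p))\<^sup>2) \<longlonglongrightarrow> (\<Sum>j=1..N. (norm (D j - D j))\<^sup>2)"
    using assms(4) by (intro tendsto_intros) auto
  from order_tendstoD(2)[OF this, of \<epsilon>] \<epsilon>
  have "\<forall>\<^sub>F p in sequentially. (\<Sum>j=1..N. (norm (D j - d j p))\<^sup>2) < \<epsilon>" by simp
  with ev have "\<forall>\<^sub>F p in sequentially. prime p \<longrightarrow> u p \<le> \<epsilon> * v p"
  proof eventually_elim
    case (elim p)
    show ?case
    proof
      assume "prime p"
      then have "(\<Sum>j=1..N. D j * a j p) = (\<Sum>j=1..N. (D j - d j p) * a j p)"
        using elim by (simp add: ring_distribs sum_subtractf)
      then have "(norm (\<Sum>j=1..N. D j * a j p))\<^sup>2 \<le> (\<Sum>j=1..N. (norm (D j - d j p))\<^sup>2) * (\<Sum>j=1..N. (norm (a j p))\<^sup>2)"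
        using norm_sum_mult_squared_le by metis
      also have "\<dots> \<le> \<epsilon> * (\<Sum>j=1..N. (norm (a j p))\<^sup>2)"
        using elim by (intro mult_right_mono sum_nonneg) auto
      finally show "u p \<le> \<epsilon> * v p"
        unfolding u_def v_def by (simp add: divide_right_mono)
    qed
  qed
  then obtain P where P: "\<And>p. p \<ge> P \<Longrightarrow> prime p \<Longrightarrow> u p \<le> \<epsilon> * v p"
    unfolding eventually_sequentially by blast
  have uv: "u p \<ge> 0" "v p \<ge> 0" for p
    by (auto simp: u_def v_def intro!: divide_nonneg_nonneg sum_nonneg)
  \<comment> \<open>The primes below \<open>P\<close>, where the estimate may fail, contribute a
    constant that disappears after division by \<open>ln (ln x)\<close>.\<close>
  have bound: "(\<Sum>p\<in>X x. u p) \<le> (\<Sum>p<P. u p) + \<epsilon> * (\<Sum>p\<in>X x. v p)" for x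
  proof -
    have "(\<Sum>p\<in>X x. u p) \<le> (\<Sum>p\<in>X x. (if p < P then u p else 0) + \<epsilon> * v p)"
      using P uv \<epsilon> by (intro sum_mono) (auto simp: X_def)
    also have "\<dots> = (\<Sum>p\<in>X x \<inter> {..<P}. u p) + \<epsilon> * (\<Sum>p\<in>X x. v p)"
      using fin by (simp add: sum.distrib sum_distrib_left sum.inter_restrict lessThan_def)
    also have "(\<Sum>p\<in>X x \<inter> {..<P}. u p) \<le> (\<Sum>p<P. u p)"
      using uv by (intro sum_mono2) auto
    finally show ?thesis by simp
  qed
  have "\<forall>\<^sub>F x::real in at_top. l x > 0"
    using filterlim_ln_ln by (simp add: filterlim_at_top_dense l_def)
  then have le: "\<forall>\<^sub>F x in at_top. (\<Sum>p\<in>X x. u p) / l x \<le> (\<Sum>p<P. u p) / l x + \<epsilon> * ((\<Sum>p\<in>X x. v p) / l x)"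
  proof eventually_elim
    case (elim x)
    then show ?case using divide_right_mono[OF bound[of x], of "l x"] by (simp add: add_divide_distrib)
  qed
  have lim_r: "((\<lambda>x. (\<Sum>p<P. u p) / l x + \<epsilon> * ((\<Sum>p\<in>X x. v p) / l x)) \<longlongrightarrow> 0 + \<epsilon> * MV) at_top"
    by (intro tendsto_add tendsto_mult_left lim_v real_tendsto_divide_at_top[OF tendsto_const])
       (use filterlim_ln_ln in \<open>simp add: l_def\<close>)
  have "MU \<le> 0 + \<epsilon> * MV"
    by (rule tendsto_le[OF _ lim_r lim_u le]) simp
  then show False using pos by (simp add: \<epsilon>_def)
qed

section \<open>Zeros near an isolated line\<close>

lemma multiplicity_eq_0_if_less:
  fixes n p :: nat
  assumes "n \<ge> 1" "n < p"
  shows "multiplicity p n = 0"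
proof -
  have "\<not> p dvd n" using assms by (auto dest: dvd_imp_le)
  then show ?thesis by (rule not_dvd_imp_multiplicity_0)
qed

lemma uniform_limit_sum:
  fixes f :: "'i \<Rightarrow> 'k \<Rightarrow> 's \<Rightarrow> 'b::real_normed_vector"
  assumes "finite J" "\<And>j. j \<in> J \<Longrightarrow> uniform_limit S (f j) (g j) G"
  shows "uniform_limit S (\<lambda>k s. \<Sum>j\<in>J. f j k s) (\<lambda>s. \<Sum>j\<in>J. g j s) G"
  using assms by (induction J rule: finite_induct) (auto intro!: uniform_limit_intros)

section \<open>Twisting the linear combination at one prime\<close>

locale dirichlet_combination =
  fixes J :: "nat set" and cs :: "nat \<Rightarrow> complex" and a :: "nat \<Rightarrow> nat \<Rightarrow> complex" and c :: complex
  assumes finite_J: "finite J" and abs_conv: "j \<in> J \<Longrightarrow> dirichlet_abs_conv (a j)"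
begin

text \<open>The constant \<open>c\<close> belongs to the term \<open>n = 1\<close>, whose
  multiplicity at \<open>p\<close> is 0, so the twist leaves it alone.\<close>

definition \<Phi> :: "nat \<Rightarrow> complex \<Rightarrow> complex \<Rightarrow> complex" where
  "\<Phi> p s z = (\<Sum>j\<in>J. cs j * dirichlet_twist (a j) (\<lambda>n. z ^ multiplicity p n) s) - c"

definition combination :: "complex \<Rightarrow> complex" where
  "combination s = (\<Sum>j\<in>J. cs j * dirichlet_twist (a j) (\<lambda>_. 1) s) - c"

lemma Phi_1: "\<Phi> p s 1 = combination s"
  by (simp add: \<Phi>_def combination_def)

lemma holomorphic_Phi: "norm z \<le> 1 \<Longrightarrow> (\<lambda>s. \<Phi> p s z) holomorphic_on {s. Re s > 1}"
  unfolding \<Phi>_def by (intro holomorphic_intros holomorphic_twist abs_conv norm_power_le_one)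

lemma holomorphic_combination: "combination holomorphic_on {s. Re s > 1}"
  using holomorphic_Phi[of 1] by (simp add: Phi_1)

lemma disc_family_Phi: "disc_family {s. Re s > 1} (\<Phi> p)"
proof
  show "continuous_on ({s. 1 < Re s} \<times> cball 0 1) (\<lambda>(s, z). \<Phi> p s z)"
    unfolding \<Phi>_def case_prod_unfold
    by (intro continuous_intros continuous_on_twist[unfolded case_prod_unfold] abs_conv)
  show "\<Phi> p s holomorphic_on ball 0 1" if "s \<in> {s. 1 < Re s}" for s
    unfolding \<Phi>_def using that by (intro holomorphic_intros holomorphic_twist_parameter abs_conv) auto
qed

lemma Phi_eventually_close:
  assumes "\<sigma> > 1" "\<epsilon> > 0"
  shows "\<exists>P. \<forall>p>P. \<forall>s z. \<sigma> \<le> Re s \<longrightarrow> norm z \<le> 1 \<longrightarrow> norm (\<Phi> p s z - combination s) < \<epsilon>"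
proof -
  \<comment> \<open>The summand 1 in the denominator avoids division by zero and yields the strict
    inequality at the end.\<close>
  define \<eta> where "\<eta> = \<epsilon> / (1 + (\<Sum>j\<in>J. norm (cs j)))"
  have den: "1 + (\<Sum>j\<in>J. norm (cs j)) > 0"
    by (intro add_pos_nonneg sum_nonneg) auto
  then have \<eta>: "\<eta> > 0" using assms(2) by (simp add: \<eta>_def)
  have "\<exists>P. \<forall>v s z. (\<forall>n\<in>{1..P}. v n = 0) \<longrightarrow> \<sigma> \<le> Re s \<longrightarrow> norm z \<le> 1 \<longrightarrow>
           norm (dirichlet_twist (a j) (\<lambda>n. z ^ v n) s - dirichlet_twist (a j) (\<lambda>_. 1) s) < \<eta>" if "j \<in> J" for j
    by (rule twist_eventually_close[OF abs_conv[OF that] assms(1) \<eta>])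
  then obtain Q where Q: "\<And>j v s z. j \<in> J \<Longrightarrow> (\<forall>n\<in>{1..Q j}. v n = 0) \<Longrightarrow> \<sigma> \<le> Re s \<Longrightarrow> norm z \<le> 1 \<Longrightarrow>
           norm (dirichlet_twist (a j) (\<lambda>n. z ^ v n) s - dirichlet_twist (a j) (\<lambda>_. 1) s) < \<eta>"
    by metis
  show ?thesis
  proof (intro exI[of _ "Max (insert 0 (Q ` J))"] allI impI)
    fix p and s z :: complex
    assume p: "Max (insert 0 (Q ` J)) < p" and s: "\<sigma> \<le> Re s" and z: "norm z \<le> 1"
    have "norm (dirichlet_twist (a j) (\<lambda>n. z ^ multiplicity p n) s - dirichlet_twist (a j) (\<lambda>_. 1) s) \<le> \<eta>"
      if "j \<in> J" for j
    proof (rule less_imp_le, rule Q[OF that _ s z], rule ballI)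
      have "Q j < p" using p that finite_J by auto
      then show "multiplicity p n = 0" if "n \<in> {1..Q j}" for n
        using that by (intro multiplicity_eq_0_if_less) auto
    qed
    note le = this
    have "\<Phi> p s z - combination s = (\<Sum>j\<in>J. cs j * (dirichlet_twist (a j) (\<lambda>n. z ^ multiplicity p n) s - dirichlet_twist (a j) (\<lambda>_. 1) s))"
      by (simp add: \<Phi>_def combination_def sum_subtractf right_diff_distrib)
    also have "norm \<dots> \<le> (\<Sum>j\<in>J. norm (cs j) * \<eta>)"
      using le by (intro order.trans[OF norm_sum] sum_mono) (auto simp: norm_mult intro!: mult_left_mono)
    also have "\<dots> = (\<Sum>j\<in>J. norm (cs j)) * \<eta>" by (simp add: sum_distrib_right)
    also have "\<dots> < (1 + (\<Sum>j\<in>J. norm (cs j))) * \<eta>" using \<eta> by (intro mult_strict_right_mono) auto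
    also have "\<dots> = \<epsilon>" using den by (simp add: \<eta>_def)
    finally show "norm (\<Phi> p s z - combination s) < \<epsilon>" .
  qed
qed

text \<open>By Kronecker's theorem \<open>\<Phi> p \<sqdot> z\<close> with \<open>\<bar>z\<bar> = 1\<close> is a limit of vertical translates of \<open>combination\<close>,
  so Hurwitz's theorem applies.\<close>

lemma Phi_zero_free_strip:
  assumes "prime p" "norm z = 1" "1 < b\<^sub>1"
    and "\<And>s. b\<^sub>1 < Re s \<Longrightarrow> Re s < b\<^sub>2 \<Longrightarrow> combination s \<noteq> 0"
    and "b\<^sub>1 < Re w" "Re w < b\<^sub>2" "\<Phi> p w z \<noteq> 0"
    and "b\<^sub>1 < Re s" "Re s < b\<^sub>2"
  shows "\<Phi> p s z \<noteq> 0"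
proof
  assume zero: "\<Phi> p s z = 0"
  obtain t where t: "\<And>\<alpha> \<sigma>. dirichlet_abs_conv \<alpha> \<Longrightarrow> \<sigma> > 1 \<Longrightarrow>
       uniform_limit {s. \<sigma> \<le> Re s} (\<lambda>k s. dirichlet_twist \<alpha> (\<lambda>_. 1) (s + \<i> * of_real (t k)))
         (dirichlet_twist \<alpha> (\<lambda>n. z ^ multiplicity p n)) sequentially"
    using kronecker_twist_limit[OF assms(1,2)] by metis
  define S where "S = {s. b\<^sub>1 < Re s} \<inter> {s. Re s < b\<^sub>2}"
  have sub: "S \<subseteq> {s. Re s > 1}" using assms(3) by (auto simp: S_def)
  have lim: "uniform_limit {s. b\<^sub>1 \<le> Re s} (\<lambda>k s. combination (s + \<i> * of_real (t k))) (\<lambda>s. \<Phi> p s z) sequentially"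
  proof -
    have "uniform_limit {s. b\<^sub>1 \<le> Re s}
       (\<lambda>k s. \<Sum>j\<in>J. cs j * dirichlet_twist (a j) (\<lambda>_. 1) (s + \<i> * of_real (t k)))
       (\<lambda>s. \<Sum>j\<in>J. cs j * dirichlet_twist (a j) (\<lambda>n. z ^ multiplicity p n) s) sequentially"
      by (intro uniform_limit_sum finite_J bounded_linear.uniform_limit[OF bounded_linear_mult_right] t abs_conv assms(3))
    then show ?thesis
      unfolding combination_def \<Phi>_def by (intro uniform_limit_intros)
  qed
  \<comment> \<open>A zero at \<open>s\<close> would make the limit of the zero-free translates
    vanish identically on the strip, in particular at \<open>w\<close>.\<close>
  have "\<Phi> p w z = 0"
  proof (rule hurwitz_zero_limit[where f = "\<lambda>k s. combination (s + \<i> * of_real (t k))" and g = "\<lambda>s. \<Phi> p s z" and S = S and w = s and z = w])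
    show "open S" unfolding S_def by (intro open_Int open_halfspace_Re_gt open_halfspace_Re_lt)
    show "connected S"
      unfolding S_def by (intro convex_connected convex_Int convex_halfspace_Re_gt convex_halfspace_Re_lt)
    show "(\<lambda>s. combination (s + \<i> * of_real (t k))) holomorphic_on S" for k
    proof -
      have "(combination \<circ> (\<lambda>s. s + \<i> * of_real (t k))) holomorphic_on S"
        using sub by (intro holomorphic_on_compose_gen[OF _ holomorphic_combination] holomorphic_intros) auto
      then show ?thesis by (simp add: comp_def)
    qed
    show "(\<lambda>s. \<Phi> p s z) holomorphic_on S"
      using assms(2) by (intro holomorphic_on_subset[OF holomorphic_Phi sub]) simp
    show "uniform_limit K (\<lambda>k s. combination (s + \<i> * of_real (t k))) (\<lambda>s. \<Phi> p s z) sequentially" if "K \<subseteq> S" for K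
      using that by (intro uniform_limit_on_subset[OF lim]) (auto simp: S_def)
    show "combination (s + \<i> * of_real (t k)) \<noteq> 0" if "s \<in> S" for k s
      using that by (intro assms(4)) (auto simp: S_def)
  qed (use zero assms in \<open>auto simp: S_def\<close>)
  then show False using assms(7) by simp
qed

text \<open>Supplies the data for \<open>zero_persists\<close>: the annulus bound comes from
  isolation of the zero, closeness from \<open>p\<close> being large, and the condition on the
  circle from Kronecker on either side of the line.\<close>

lemma Phi_vanishes_on_isolated_line:
  assumes "combination s\<^sub>0 = 0" "Re s\<^sub>0 > 1" "\<delta> > 0"
    and strip: "\<And>s. 0 < \<bar>Re s - Re s\<^sub>0\<bar> \<Longrightarrow> \<bar>Re s - Re s\<^sub>0\<bar> < \<delta> \<Longrightarrow> combination s \<noteq> 0"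
  shows "\<exists>P. \<forall>p>P. prime p \<longrightarrow> (\<forall>z. norm z \<le> 1 \<longrightarrow> \<Phi> p s\<^sub>0 z = 0)"
proof -
  let ?H = "{s. Re s > 1}"
  \<comment> \<open>Shrinks the strip so that it stays strictly to the right of the line with real
    part 1.\<close>
  define \<delta>' where "\<delta>' = min \<delta> ((Re s\<^sub>0 - 1) / 2)"
  have \<delta>': "\<delta>' > 0" "\<delta>' \<le> \<delta>" "Re s\<^sub>0 - \<delta>' > 1"
    using assms(2,3) by (auto simp: \<delta>'_def min_def field_simps)
  \<comment> \<open>A point of the strip off the line; it shows that \<open>combination\<close> is
    not identically zero, so its zeros are isolated.\<close>
  define w where "w = s\<^sub>0 + of_real (\<delta>' / 2)"
  have "Re w = Re s\<^sub>0 + \<delta>' / 2" by (simp add: w_def)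
  then have w: "w \<in> ?H" "combination w \<noteq> 0"
    using \<delta>' assms(2) strip[of w] by auto
  have "s\<^sub>0 \<in> ?H" using assms(2) by simp
  then obtain r where r: "r > 0" "\<And>s. s \<in> ball s\<^sub>0 r - {s\<^sub>0} \<Longrightarrow> combination s \<noteq> 0"
    using isolated_zeros[OF holomorphic_combination open_halfspace_Re_gt
        convex_connected[OF convex_halfspace_Re_gt] _ assms(1) w] by metis
  define d where "d = min r \<delta>' / 2"
  have d: "d > 0" "d < r" "d < \<delta>'" using r(1) \<delta>' by (auto simp: d_def min_def)
  have Re_near: "\<bar>Re s - Re s\<^sub>0\<bar> \<le> d" if "s \<in> cball s\<^sub>0 d" for s
    using that abs_Re_le_cmod[of "s - s\<^sub>0"] by (auto simp: dist_norm norm_minus_commute)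
  have sub: "cball s\<^sub>0 d \<subseteq> ?H"
  proof
    fix s assume "s \<in> cball s\<^sub>0 d"
    from Re_near[OF this] show "s \<in> ?H" using d \<delta>' by auto
  qed
  define A where "A = cball s\<^sub>0 d - ball s\<^sub>0 (d/2)"
  have "compact A" unfolding A_def by (intro compact_diff) auto
  moreover have "s\<^sub>0 + of_real d \<in> A" using d by (auto simp: A_def dist_norm)
  moreover have "continuous_on A (\<lambda>s. norm (combination s))"
    using sub by (intro continuous_intros continuous_on_subset[OF holomorphic_on_imp_continuous_on[OF holomorphic_combination]])
      (auto simp: A_def)
  ultimately obtain x where x: "x \<in> A" "\<And>s. s \<in> A \<Longrightarrow> norm (combination x) \<le> norm (combination s)"
    using continuous_attains_inf[of A "\<lambda>s. norm (combination s)"] by blast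
  \<comment> \<open>The minimum over the closed annulus is positive because \<open>s\<^sub>0\<close>
    is the only zero in the ball of radius \<open>r\<close>, and \<open>d < r\<close>.\<close>
  define m where "m = norm (combination x)"
  have "x \<noteq> s\<^sub>0" using x(1) d by (auto simp: A_def)
  then have m: "m > 0" using r(2)[of x] x(1) d by (auto simp: m_def A_def)
  have "\<exists>P. \<forall>p>P. \<forall>s z. Re s\<^sub>0 - \<delta>' \<le> Re s \<longrightarrow> norm z \<le> 1 \<longrightarrow> norm (\<Phi> p s z - combination s) < m/2"
    using \<delta>' m by (intro Phi_eventually_close) auto
  then obtain P where P: "\<And>p s z. p > P \<Longrightarrow> Re s\<^sub>0 - \<delta>' \<le> Re s \<Longrightarrow> norm z \<le> 1 \<Longrightarrow> norm (\<Phi> p s z - combination s) < m/2"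
    by blast
  have "\<Phi> p s\<^sub>0 z = 0" if p: "p > P" "prime p" and z: "norm z \<le> 1" for p z
  proof -
    interpret disc_family ?H "\<Phi> p" by (rule disc_family_Phi)
    have close: "norm (\<Phi> p s z - combination s) < m/2" if "s \<in> cball s\<^sub>0 d" "norm z \<le> 1" for s z
      using Re_near[OF that(1)] d(3) that(2) p(1) by (intro P) auto
    have far: "\<Phi> p w z \<noteq> 0" if w: "w \<in> A" "norm z \<le> 1" for w z
    proof
      assume "\<Phi> p w z = 0"
      then have "norm (combination w) < m/2" using close[of w z] w by (simp add: A_def)
      then show False using x(2)[OF w(1)] m norm_ge_zero[of "combination w"] unfolding m_def by linarith
    qed
    have circle: "\<Phi> p s z \<noteq> 0" if s: "s \<in> ball s\<^sub>0 d" "Re s \<noteq> Re s\<^sub>0" and z: "norm z = 1" for s z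
    proof -
      have Re_s: "\<bar>Re s - Re s\<^sub>0\<bar> < \<delta>'" using Re_near[of s] s d by simp
      show ?thesis
      proof (cases "Re s > Re s\<^sub>0")
        case True
        \<comment> \<open>The rightmost point of the closed disc serves as the non-vanishing point
          for the strip to the right of the line; the leftmost one plays this part in the other
          case.\<close>
        have "s\<^sub>0 + of_real d \<in> A" using d by (auto simp: A_def dist_norm)
        then have w: "\<Phi> p (s\<^sub>0 + of_real d) z \<noteq> 0" using z by (intro far) auto
        show ?thesis
        proof (rule Phi_zero_free_strip[OF p(2) z _ _ _ _ w])
          show "combination s' \<noteq> 0" if "Re s\<^sub>0 < Re s'" "Re s' < Re s\<^sub>0 + \<delta>'" for s'
            using that \<delta>'(2) by (intro strip) auto
        qed (use assms(2) True Re_s d in auto)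
      next
        case False
        have "s\<^sub>0 - of_real d \<in> A" using d by (auto simp: A_def dist_norm)
        then have w: "\<Phi> p (s\<^sub>0 - of_real d) z \<noteq> 0" using z by (intro far) auto
        show ?thesis
        proof (rule Phi_zero_free_strip[OF p(2) z _ _ _ _ w])
          show "combination s' \<noteq> 0" if "Re s\<^sub>0 - \<delta>' < Re s'" "Re s' < Re s\<^sub>0" for s'
            using that \<delta>'(2) by (intro strip) auto
        qed (use \<delta>'(3) False s(2) Re_s d in auto)
      qed
    qed
    show ?thesis
    proof (rule zero_persists[of _ d m])
      show "cball s\<^sub>0 d \<subseteq> ?H" by (rule sub)
      show "(\<lambda>s. \<Phi> p s 0) holomorphic_on ?H" by (rule holomorphic_Phi) simp
      show "open ?H" by (rule open_halfspace_Re_gt)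
      show "m \<le> norm (\<Phi> p s 1)" if "d/2 \<le> dist s\<^sub>0 s" "dist s\<^sub>0 s \<le> d" for s
        using x(2)[of s] that by (simp add: Phi_1 m_def A_def)
      show "s = s\<^sub>0" if "s \<in> cball s\<^sub>0 d" "\<Phi> p s 1 = 0" for s
        using r(2)[of s] that d by (auto simp: Phi_1)
      show "norm (\<Phi> p s z - \<Phi> p s 1) < m/2" if "s \<in> cball s\<^sub>0 d" "norm z \<le> 1" for s z
        using close[OF that] by (simp add: Phi_1)
    qed (use d m z circle assms(1) in \<open>auto simp: Phi_1\<close>)
  qed
  then show ?thesis by blast
qed

end

section \<open>Vanishing derivatives at large primes against orthogonality\<close>

theorem theorem5:
  fixes N :: nat and c :: complex and cs :: "nat \<Rightarrow> complex"
    and F :: "nat \<Rightarrow> complex \<Rightarrow> complex" and a :: "nat \<Rightarrow> nat \<Rightarrow> complex"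
    and L :: "complex \<Rightarrow> complex"
  assumes "N \<ge> 3"
    and "\<And>j. j \<in> {1..N} \<Longrightarrow> cs j \<noteq> 0"
    and "\<And>j. j \<in> {1..N} \<Longrightarrow> axiom_I (F j) (a j)"
    and "\<And>j. j \<in> {1..N} \<Longrightarrow> axiom_II (F j)"
    and "\<And>j. j \<in> {1..N} \<Longrightarrow> axiom_III (a j)"
    and "orthogonal_coeffs N a"
    and "\<And>s. L s = (\<Sum>j=1..N. cs j * F j s) - c"
  shows "\<not> (\<exists>\<beta>\<^sub>0>1. isolated_zero_line L \<beta>\<^sub>0)"
proof
  assume "\<exists>\<beta>\<^sub>0>1. isolated_zero_line L \<beta>\<^sub>0"
  then obtain \<beta>\<^sub>0 \<gamma> \<delta> where \<beta>\<^sub>0: "\<beta>\<^sub>0 > 1" "L (Complex \<beta>\<^sub>0 \<gamma>) = 0" "\<delta> > 0"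
    and strip: "\<And>\<beta> \<gamma>. 0 < \<bar>\<beta> - \<beta>\<^sub>0\<bar> \<Longrightarrow> \<bar>\<beta> - \<beta>\<^sub>0\<bar> < \<delta> \<Longrightarrow> L (Complex \<beta> \<gamma>) \<noteq> 0"
    unfolding isolated_zero_line_def by blast
  define s\<^sub>0 where "s\<^sub>0 = Complex \<beta>\<^sub>0 \<gamma>"
  have s\<^sub>0: "Re s\<^sub>0 > 1" using \<beta>\<^sub>0 by (simp add: s\<^sub>0_def)
  have conv: "dirichlet_abs_conv (a j)" if "j \<in> {1..N}" for j
    using axiom_I_twist(1) assms(3)[OF that] .
  have F: "F j s = dirichlet_twist (a j) (\<lambda>_. 1) s" if "j \<in> {1..N}" "Re s > 1" for j s
    using axiom_I_twist(2)[OF assms(3)[OF that(1)] that(2)] .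
  interpret dirichlet_combination "{1..N}" cs a c
    by unfold_locales (auto intro: conv)
  have L: "L s = combination s" if "Re s > 1" for s
    unfolding assms(7) combination_def using F[OF _ that] by simp
  \<comment> \<open>\<open>L\<close> agrees with \<open>combination\<close> only for real part above
    1, hence the minimum with \<open>\<beta>\<^sub>0 - 1\<close>.\<close>
  have "combination s \<noteq> 0" if "0 < \<bar>Re s - Re s\<^sub>0\<bar>" "\<bar>Re s - Re s\<^sub>0\<bar> < min \<delta> (\<beta>\<^sub>0 - 1)" for s
  proof -
    have "Re s > 1" using that(2) by (auto simp: s\<^sub>0_def abs_less_iff)
    then show ?thesis using that strip[of "Re s" "Im s"] L[of s] by (simp add: s\<^sub>0_def)
  qed
  moreover have "combination s\<^sub>0 = 0" using L[OF s\<^sub>0] \<beta>\<^sub>0(2) by (simp add: s\<^sub>0_def)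
  ultimately obtain P where P: "\<And>p z. p > P \<Longrightarrow> prime p \<Longrightarrow> norm z \<le> 1 \<Longrightarrow> \<Phi> p s\<^sub>0 z = 0"
    using Phi_vanishes_on_isolated_line[of s\<^sub>0 "min \<delta> (\<beta>\<^sub>0 - 1)"] \<beta>\<^sub>0(1,3) s\<^sub>0 by auto
  \<comment> \<open>These are the coefficients of \<open>a j p\<close> in the derivative at
    \<open>z = 0\<close>, up to the common factor \<open>p powr (-s\<^sub>0)\<close>.\<close>
  define d where "d = (\<lambda>j p. cs j * dirichlet_twist (a j) (\<lambda>n. 0 ^ multiplicity p n) s\<^sub>0)"
  have "(\<Sum>j=1..N. d j p * a j p) = 0" if p: "p > P" "prime p" for p
  proof -
    let ?T1 = "\<lambda>j. dirichlet_twist (a j) (\<lambda>n. if multiplicity p n = 1 then 1 else 0) s\<^sub>0"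
    \<comment> \<open>The derivative is computed termwise here, and it is 0 because
      \<open>\<Phi> p s\<^sub>0\<close> vanishes on the whole disc.\<close>
    have deriv: "(\<Phi> p s\<^sub>0 has_field_derivative (\<Sum>j=1..N. cs j * ?T1 j) - 0) (at 0)"
      unfolding \<Phi>_def[abs_def]
      by (intro DERIV_diff DERIV_sum DERIV_cmult DERIV_const twist_parameter_derivative conv s\<^sub>0)
    have eq: "0 = \<Phi> p s\<^sub>0 z" if "z \<in> ball 0 1" for z
      using P[OF p, of z] that by simp
    have "(\<Phi> p s\<^sub>0 has_field_derivative 0) (at 0)"
      by (rule has_field_derivative_transform_within_open[OF DERIV_const open_ball[of 0 1] _ eq]) auto
    then have "(\<Sum>j=1..N. cs j * ?T1 j) = 0" using DERIV_unique[OF deriv] by simp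
    moreover have "cs j * ?T1 j = d j p * a j p * of_nat p powr (- s\<^sub>0)" if j: "j \<in> {1..N}" for j
    proof -
      obtain \<beta> where \<beta>: "dirichlet_abs_conv \<beta>" "\<And>n. \<not> primepow n \<Longrightarrow> \<beta> n = 0"
        "\<And>s. Re s > 1 \<Longrightarrow> F j s = exp (dirichlet_twist \<beta> (\<lambda>_. 1) s)"
        by (rule axiom_II_twist[OF assms(4)[OF j]]) (rule that; blast)
      have "?T1 j = dirichlet_twist (a j) (\<lambda>n. 0 ^ multiplicity p n) s\<^sub>0 * a j p * of_nat p powr (- s\<^sub>0)"
        by (rule twist_prime_multiplicity_one[OF conv[OF j] \<beta>(1) p(2) s\<^sub>0 \<beta>(2)])
          (simp_all add: F[OF j, symmetric] \<beta>(3))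
      then show ?thesis by (simp add: d_def)
    qed
    ultimately have "(\<Sum>j=1..N. d j p * a j p) * of_nat p powr (- s\<^sub>0) = 0"
      by (simp add: sum_distrib_right)
    then show ?thesis using prime_gt_0_nat[OF p(2)] by simp
  qed
  then have "\<forall>\<^sub>F p in sequentially. prime p \<longrightarrow> (\<Sum>j=1..N. d j p * a j p) = 0"
    by (intro eventually_mono[OF eventually_gt_at_top[of P]]) auto
  moreover have "d j \<longlonglongrightarrow> cs j * F j s\<^sub>0" if j: "j \<in> {1..N}" for j
  proof -
    have "(\<lambda>p. dirichlet_twist (a j) (\<lambda>n. 0 ^ multiplicity p n) s\<^sub>0) \<longlonglongrightarrow> dirichlet_twist (a j) (\<lambda>_. 1) s\<^sub>0"
    proof (rule tendsto_uniform_limitI[OF uniform_limit_twist[OF conv[OF j] s\<^sub>0]])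
      \<comment> \<open>The limit runs over all natural numbers \<open>p\<close>, prime or not: once
        \<open>p > n\<close> the multiplicity is 0, and \<open>0 ^ 0 = 1\<close>.\<close>
      show "(\<lambda>p. 0 ^ multiplicity p n) \<longlonglongrightarrow> (1 :: complex)" if "n \<ge> 1" for n
        by (intro tendsto_eventually eventually_mono[OF eventually_gt_at_top[of n]])
          (simp add: multiplicity_eq_0_if_less[OF that])
    qed (auto simp: norm_power_le_one)
    then show ?thesis unfolding d_def F[OF j s\<^sub>0] by (rule tendsto_mult_left)
  qed
  \<comment> \<open>\<open>F j s\<^sub>0\<close> is an exponential, so the limit coefficients do not
    vanish.\<close>
  moreover have "cs j * F j s\<^sub>0 \<noteq> 0" if j: "j \<in> {1..N}" for j
  proof -
    obtain \<beta> where "\<And>s. Re s > 1 \<Longrightarrow> F j s = exp (dirichlet_twist \<beta> (\<lambda>_. 1) s)"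
      by (rule axiom_II_twist[OF assms(4)[OF j]]) (rule that; blast)
    from this[OF s\<^sub>0] show ?thesis using assms(2)[OF j] by simp
  qed
  ultimately show False
    using orthogonal_coeffs_independent[OF assms(6), of "\<lambda>j. cs j * F j s\<^sub>0" d] assms(1) by auto
qed

end
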